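(* Let $q,r,f$ be positive integers and let $L_1,\ldots,L_f$ be mutually orthogonal Sudoku Latin squares of order $qr$ of type $(q,r)$ on the symbol set $[qr]$. Let $A_{[f],\mathrm{MOLS}}$, $B$ and $A_{[f],\mathrm{MOSLS}}=A_{[f],\mathrm{MOLS}}+B$ be the matrices attached to $L_1,\ldots,L_f$ as defined in the context. If $A_{[f],\mathrm{MOLS}}$ and $B$ commute, then the spectrum of $A_{[f],\mathrm{MOSLS}}$ is \begin{align*} \{&[(q-1)(r-1)+(qr-1)(f+2)]^1,\ [(q-1)(r-1)+qr-2-f]^{q+r-2},\\ &[(q-1)(r-1)-2-f]^{(q-1)(r-1)},\ [qr-1-f]^{f(q-1)(r-1)},\\ &[qr-q-1-f]^{(r-1)(q+f)},\ [qr-r-1-f]^{(q-1)(r+f)},\ [-1-f]^{(q-1)(r-1)(qr-f)},\\ &[-q-1-f]^{(r-1)(qr-q-f)},\ [-r-1-f]^{(q-1)(qr-r-f)}\}. \end{align*}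
   Context: $[n]=\{1,\ldots,n\}$. A Latin square of order $n$ on $[n]$ is an $n\times n$ array with entries in $[n]$ such that every row and every column contains each symbol exactly once. Two Latin squares $L,L'$ of order $n$ are orthogonal if the pairs $(L(a,b),L'(a,b))$, $a,b\in[n]$, are distinct; a family is mutually orthogonal if any two distinct members are orthogonal (a single square is allowed). For $i\in[r]$, $j\in[q]$ put $B_{i,j}=\{(a,b): (i-1)q+1\le a\le iq,\ (j-1)r+1\le b\le jr\}$; these $q\times r$ blocks partition $[qr]^2$. A Latin square of order $qr$ is a Sudoku Latin square of type $(q,r)$ if in each block $B_{i,j}$ every symbol of $[qr]$ occurs exactly once ($q=1$ or $r=1$ is allowed). Let $C=\{(a,b,L_1(a,b),\ldots,L_f(a,b)): a,b\in[qr]\}\subset[qr]^{f+2}$. All matrices are indexed by $C$. $A_{[f],\mathrm{MOLS}}$ is the $(0,1)$-matrix with $(x,y)$-entry $1$ iff the Hamming distance of $x,y$ is $f+1$ (i.e. $x,y$ agree in exactly one coordinate). $B$ is the $(0,1)$-matrix with $(x,y)$-entry $1$ iff the cells $(x_1,x_2),(y_1,y_2)$ lie in a common block $B_{i,j}$ and $x_1\ne y_1$, $x_2\neq y_2$. Then $A_{[f],\mathrm{MOSLS}}=A_{[f],\mathrm{MOLS}}+B$ is the adjacency matrix of the graph $G_{[f],\mathrm{MOSLS}}$ on $C$ in which distinct $x,y$ are adjacent iff they agree in exactly one coordinate or their cells lie in a common block. The spectrum is the multiset of eigenvalues; $[\theta]^m$ means eigenvalue $\theta$ listed with multiplicity $m$,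 where listed values that coincide have their multiplicities added and multiplicity $0$ means the entry is absent. *)

theory Defs
  imports Complex_Main "Jordan_Normal_Form.Char_Poly"
begin

text \<open>
  A square of order \<open>n\<close> is a function on \<open>nat \<times> nat\<close> (curried) of which only the values on
  \<open>{1..n} \<times> {1..n}\<close> matter.
\<close>

definition latin_square :: "nat \<Rightarrow> (nat \<Rightarrow> nat \<Rightarrow> nat) \<Rightarrow> bool" where
  "latin_square n L \<longleftrightarrow>
     (\<forall>a\<in>{1..n}. \<forall>b\<in>{1..n}. L a b \<in> {1..n}) \<and>
     (\<forall>a\<in>{1..n}. \<forall>s\<in>{1..n}. \<exists>!b. b \<in> {1..n} \<and> L a b = s) \<and>
     (\<forall>b\<in>{1..n}. \<forall>s\<in>{1..n}. \<exists>!a. a \<in> {1..n} \<and> L a b = s)"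

definition orthogonal_squares ::
  "nat \<Rightarrow> (nat \<Rightarrow> nat \<Rightarrow> nat) \<Rightarrow> (nat \<Rightarrow> nat \<Rightarrow> nat) \<Rightarrow> bool" where
  "orthogonal_squares n L L' \<longleftrightarrow>
     inj_on (\<lambda>(a, b). (L a b, L' a b)) ({1..n} \<times> {1..n})"

text \<open>The family is indexed by \<open>k \<in> {1..f}\<close>; ``distinct members'' means distinct indices.\<close>

definition mutually_orthogonal ::
  "nat \<Rightarrow> nat \<Rightarrow> (nat \<Rightarrow> nat \<Rightarrow> nat \<Rightarrow> nat) \<Rightarrow> bool" where
  "mutually_orthogonal n f L \<longleftrightarrow>
     (\<forall>k\<in>{1..f}. \<forall>l\<in>{1..f}. k \<noteq> l \<longrightarrow> orthogonal_squares n (L k) (L l))"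

text \<open>Below, \<open>block q r i j\<close> is used for \<open>i \<in> {1..r}\<close> and \<open>j \<in> {1..q}\<close> only.\<close>

definition block :: "nat \<Rightarrow> nat \<Rightarrow> nat \<Rightarrow> nat \<Rightarrow> (nat \<times> nat) set" where
  "block q r i j =
     {(a, b). (i - 1) * q + 1 \<le> a \<and> a \<le> i * q \<and> (j - 1) * r + 1 \<le> b \<and> b \<le> j * r}"

definition sudoku_latin_square :: "nat \<Rightarrow> nat \<Rightarrow> (nat \<Rightarrow> nat \<Rightarrow> nat) \<Rightarrow> bool" where
  "sudoku_latin_square q r L \<longleftrightarrow>
     latin_square (q * r) L \<and>
     (\<forall>i\<in>{1..r}. \<forall>j\<in>{1..q}. \<forall>s\<in>{1..q * r}.
        \<exists>!c. c \<in> block q r i j \<and> L (fst c) (snd c) = s)"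

definition mosls :: "nat \<Rightarrow> nat \<Rightarrow> nat \<Rightarrow> (nat \<Rightarrow> nat \<Rightarrow> nat \<Rightarrow> nat) \<Rightarrow> bool" where
  "mosls q r f L \<longleftrightarrow>
     (\<forall>k\<in>{1..f}. sudoku_latin_square q r (L k)) \<and> mutually_orthogonal (q * r) f L"

text \<open>
  Tuples \<open>(a, b, L\<^sub>1(a,b), \<dots>, L\<^sub>f(a,b))\<close> are lists of length \<open>f + 2\<close>; list positions are
  counted from 0, so the cell of a tuple \<open>x\<close> is \<open>(x ! 0, x ! 1)\<close>.
\<close>

definition codeword :: "nat \<Rightarrow> (nat \<Rightarrow> nat \<Rightarrow> nat \<Rightarrow> nat) \<Rightarrow> nat \<Rightarrow> nat \<Rightarrow> nat list" where
  "codeword f L a b = a # b # map (\<lambda>k. L k a b) [1..<Suc f]"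

definition code :: "nat \<Rightarrow> nat \<Rightarrow> (nat \<Rightarrow> nat \<Rightarrow> nat \<Rightarrow> nat) \<Rightarrow> nat list set" where
  "code n f L = {codeword f L a b |a b. a \<in> {1..n} \<and> b \<in> {1..n}}"

definition hamming_dist :: "'a list \<Rightarrow> 'a list \<Rightarrow> nat" where
  "hamming_dist x y = card {k. k < length x \<and> x ! k \<noteq> y ! k}"

definition same_block :: "nat \<Rightarrow> nat \<Rightarrow> nat list \<Rightarrow> nat list \<Rightarrow> bool" where
  "same_block q r x y \<longleftrightarrow>
     (\<exists>i\<in>{1..r}. \<exists>j\<in>{1..q}. (x ! 0, x ! 1) \<in> block q r i j \<and> (y ! 0, y ! 1) \<in> block q r i j)"

text \<open>
  A matrix indexed by a finite set is represented by a matrix with rows and columns indexed by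
  \<open>{0..<length xs}\<close>, where the list \<open>xs\<close> enumerates that set without repetition. The entries are
  complex, so that the spectrum below contains all eigenvalues.
\<close>

definition rel_mat :: "'a list \<Rightarrow> ('a \<Rightarrow> 'a \<Rightarrow> bool) \<Rightarrow> complex mat" where
  "rel_mat xs P = mat (length xs) (length xs) (\<lambda>(i, j). if P (xs ! i) (xs ! j) then 1 else 0)"

definition A_MOLS :: "nat \<Rightarrow> nat list list \<Rightarrow> complex mat" where
  "A_MOLS f xs = rel_mat xs (\<lambda>x y. hamming_dist x y = f + 1)"

definition B_mat :: "nat \<Rightarrow> nat \<Rightarrow> nat list list \<Rightarrow> complex mat" where
  "B_mat q r xs = rel_mat xs (\<lambda>x y. same_block q r x y \<and> x ! 0 \<noteq> y ! 0 \<and> x ! 1 \<noteq> y ! 1)"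

definition A_MOSLS :: "nat \<Rightarrow> nat \<Rightarrow> nat \<Rightarrow> nat list list \<Rightarrow> complex mat" where
  "A_MOSLS q r f xs = A_MOLS f xs + B_mat q r xs"

text \<open>Eigenvalues with algebraic multiplicity.\<close>

definition spectrum_mset :: "complex mat \<Rightarrow> complex multiset" where
  "spectrum_mset M = proots (char_poly M)"

text \<open>
  The entry \<open>[\<theta>]\<^sup>m\<close> of a spectrum. Multiplicities are given by integer expressions, so that no
  truncated subtraction occurs inside them. If the \<open>n\<close> eigenvalues of an
  \<open>n \<times> n\<close> matrix are listed with integers \<open>m\<close> adding up to \<open>n\<close>, then the conversion \<open>nat m\<close>
  cannot hide a negative \<open>m\<close>, since the list would then have more than \<open>n\<close> elements.
\<close>

definition eig :: "int \<Rightarrow> int \<Rightarrow> complex multiset" where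
  "eig \<theta> m = replicate_mset (nat m) (of_int \<theta>)"

end

theory Submission
  imports Defs "Jordan_Normal_Form.Schur_Decomposition"
begin

text \<open>
  Let \<open>n = qr\<close>, \<open>m = f + 2\<close>, let \<open>J\<close> be the all-ones matrix and \<open>H\<close> the matrix counting the coordinates in
  which two codewords agree. Then \<open>A = H - m I\<close> and \<open>H\<^sup>2 = n H + m (m - 1) J\<close>, so \<open>A\<close> has three
  spectral projections \<open>P\<^sub>i\<close>, lying in the span of \<open>I, J, A\<close>. Similarly \<open>B = K - R - D + I\<close>, where
  \<open>K\<close>, \<open>R\<close>, \<open>D\<close> are the relations ``same block'', ``same block and row'', ``same block and column'',
  and \<open>B\<close> has four spectral projections \<open>Q\<^sub>j\<close> in the span of \<open>I, R, D, K\<close>. If \<open>A\<close> and \<open>B\<close> commute,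
  then \<open>(A + B)\<^sup>k = \<Sum>\<^sub>i\<^sub>j (\<alpha>\<^sub>i + \<beta>\<^sub>j)\<^sup>k P\<^sub>i Q\<^sub>j\<close> for all \<open>k\<close>. Hence the power sums of the spectrum of
  \<open>A + B\<close> are those of the list in which \<open>\<alpha>\<^sub>i + \<beta>\<^sub>j\<close> has multiplicity \<open>tr (P\<^sub>i Q\<^sub>j)\<close>, and these traces
  only require counting. No distinction according to coincidences among the eigenvalues (such as
  for \<open>q = r\<close>) is needed.
\<close>

section \<open>Spectra of sums of commuting matrices\<close>

definition mat_trace :: "'a::comm_monoid_add mat \<Rightarrow> 'a" where
  "mat_trace A = (\<Sum>i<dim_row A. A $$ (i, i))"

lemma mult_mat_index_sum:
  assumes "A \<in> carrier_mat n m" "B \<in> carrier_mat m l" "i < n" "j < l"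
  shows "(A * B) $$ (i, j) = (\<Sum>k<m. A $$ (i, k) * B $$ (k, j))"
  using assms by (auto simp: scalar_prod_def lessThan_atLeast0 intro!: sum.cong)

lemma mat_trace_mult:
  assumes "A \<in> carrier_mat n m" "B \<in> carrier_mat m n"
  shows "mat_trace (A * B) = (\<Sum>i<n. \<Sum>k<m. A $$ (i, k) * B $$ (k, i))"
proof -
  have "mat_trace (A * B) = (\<Sum>i<n. (A * B) $$ (i, i))"
    using assms by (simp add: mat_trace_def)
  also have "\<dots> = (\<Sum>i<n. \<Sum>k<m. A $$ (i, k) * B $$ (k, i))"
    using assms by (intro sum.cong refl mult_mat_index_sum) auto
  finally show ?thesis .
qed

lemma mat_trace_comm:
  fixes A B :: "'a::comm_semiring_0 mat"
  assumes "A \<in> carrier_mat n m" "B \<in> carrier_mat m n"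
  shows "mat_trace (A * B) = mat_trace (B * A)"
  unfolding mat_trace_mult[OF assms] mat_trace_mult[OF assms(2,1)]
  by (subst sum.swap) (simp add: mult.commute)

lemma upper_triangular_pow:
  fixes A :: "'a::comm_semiring_1 mat"
  assumes A: "A \<in> carrier_mat n n" and ut: "upper_triangular A"
  shows "upper_triangular (A ^\<^sub>m k) \<and> (\<forall>i<n. (A ^\<^sub>m k) $$ (i, i) = (A $$ (i, i)) ^ k)"
proof (induction k)
  case 0
  then show ?case using A by auto
next
  case (Suc k)
  have Ak: "A ^\<^sub>m k \<in> carrier_mat n n" using A by simp
  have entry: "(A ^\<^sub>m Suc k) $$ (i, j) = (\<Sum>l<n. (A ^\<^sub>m k) $$ (i, l) * A $$ (l, j))"
    if "i < n" "j < n" for i j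
    using mult_mat_index_sum[OF Ak A that] by simp
  have z1: "(A ^\<^sub>m k) $$ (i, l) = 0" if "l < i" "i < n" for i l
    using Suc upper_triangularD[of "A ^\<^sub>m k" l i] that Ak by auto
  have z2: "A $$ (i, l) = 0" if "l < i" "i < n" for i l
    using ut upper_triangularD[of A l i] that A by auto
  have term0: "(A ^\<^sub>m k) $$ (i, l) * A $$ (l, j) = 0" if "i < n" "l < n" "l < i \<or> j < l" for i j l
    using z1[of l i] z2[of j l] that by auto
  have "upper_triangular (A ^\<^sub>m Suc k)"
  proof (rule upper_triangularI)
    fix i j assume ij: "j < i" "i < dim_row (A ^\<^sub>m Suc k)"
    then have "i < n" "j < n" using A by auto
    then show "(A ^\<^sub>m Suc k) $$ (i, j) = 0"
      using ij by (subst entry) (auto intro!: sum.neutral term0)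
  qed
  moreover have "(A ^\<^sub>m Suc k) $$ (i, i) = (A $$ (i, i)) ^ Suc k" if i: "i < n" for i
  proof -
    have "(A ^\<^sub>m Suc k) $$ (i, i) = (\<Sum>l\<in>{i}. (A ^\<^sub>m k) $$ (i, l) * A $$ (l, i))"
      unfolding entry[OF i i] using i
      by (intro sum.mono_neutral_right ballI term0) auto
    then show ?thesis using Suc i by (simp add: mult.commute)
  qed
  ultimately show ?case by blast
qed

lemma power_sum_proots_char_poly:
  fixes M :: "complex mat"
  assumes M: "M \<in> carrier_mat n n"
  shows "(\<Sum>x\<in>#proots (char_poly M). x ^ k) = mat_trace (M ^\<^sub>m k)"
proof -
  obtain es where es: "char_poly M = (\<Prod>a\<leftarrow>es. [:- a, 1:])"
    using char_poly_factorized[OF M] by blast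
  obtain T P Q where schur: "schur_decomposition M es = (T, P, Q)"
    by (cases "schur_decomposition M es")
  have wit: "similar_mat_wit M T P Q" and ut: "upper_triangular T" and diag: "diag_mat T = es"
    using schur_decomposition[OF M es schur] by auto
  note c = similar_mat_witD2[OF M wit]
  have T: "T \<in> carrier_mat n n" and P: "P \<in> carrier_mat n n" and Q: "Q \<in> carrier_mat n n"
    and QP: "Q * P = 1\<^sub>m n" using c by auto
  have Tk: "T ^\<^sub>m k \<in> carrier_mat n n" using T by simp
  have "mat_trace (M ^\<^sub>m k) = mat_trace (P * T ^\<^sub>m k * Q)"
    using similar_mat_wit_pow_id[OF wit] by simp
  also have "\<dots> = mat_trace (Q * (P * T ^\<^sub>m k))"
    using P Q Tk by (intro mat_trace_comm[of _ n n]) auto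
  also have "Q * (P * T ^\<^sub>m k) = T ^\<^sub>m k"
    using assoc_mult_mat[OF Q P Tk] QP left_mult_one_mat[OF Tk] by simp
  also have "mat_trace (T ^\<^sub>m k) = (\<Sum>i<n. (T $$ (i, i)) ^ k)"
    using upper_triangular_pow[OF T ut, of k] T by (simp add: mat_trace_def)
  also have "\<dots> = (\<Sum>a\<leftarrow>es. a ^ k)"
    using T by (simp add: diag[symmetric] diag_mat_def sum_list_sum_nth lessThan_atLeast0)
  also have "\<dots> = (\<Sum>x\<in>#mset es. x ^ k)"
    by (metis mset_map sum_mset_sum_list)
  also have "mset es = proots (char_poly M)"
    unfolding es
    by (induction es) (auto simp: proots_mult prod_list_zero_iff image_iff simp del: mult_pCons_left)
  finally show ?thesis by simp
qed

lemma multiset_eq_if_power_sums_eq: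
  fixes S T :: "'a::{idom,ring_char_0} multiset" 
  assumes pow: "\<And>k. (\<Sum>x\<in>#S. x ^ k) = (\<Sum>x\<in>#T. x ^ k)"
  shows "S = T"
proof (rule multiset_eqI)
  fix z :: 'a
  have expand: "(\<Sum>x\<in>#U. poly p x) = (\<Sum>k\<le>degree p. coeff p k * (\<Sum>x\<in>#U. x ^ k))"
    for U and p :: "'a poly"
    by (induction U) (auto simp: poly_altdef sum.distrib algebra_simps)
  have poly: "(\<Sum>x\<in>#S. poly p x) = (\<Sum>x\<in>#T. poly p x)" for p
    by (simp add: expand pow)
  define p where "p = (\<Prod>y\<in>(set_mset S \<union> set_mset T) - {z}. [:- y, 1:])"
  have pz: "poly p z \<noteq> 0"
    by (auto simp: p_def poly_prod)
  have p0: "poly p x = 0" if "x \<in> set_mset S \<union> set_mset T" "x \<noteq> z" for x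
    using that by (auto simp: p_def poly_prod)
  have count: "(\<Sum>x\<in>#U. poly p x) = of_nat (count U z) * poly p z"
    if "set_mset U \<subseteq> set_mset S \<union> set_mset T" for U
    using that by (induction U) (auto simp: p0 algebra_simps)
  show "count S z = count T z"
    using poly[of p] count[of S] count[of T] pz by simp
qed

lemma sum_rotate:
  "(\<Sum>i\<in>I. \<Sum>j\<in>J. \<Sum>z\<in>Z. f i j z) = (\<Sum>z\<in>Z. \<Sum>i\<in>I. \<Sum>j\<in>J. f i j z)"
proof -
  have "(\<Sum>i\<in>I. \<Sum>j\<in>J. \<Sum>z\<in>Z. f i j z) = (\<Sum>i\<in>I. \<Sum>z\<in>Z. \<Sum>j\<in>J. f i j z)"
    by (intro sum.cong refl sum.swap)
  also have "\<dots> = (\<Sum>z\<in>Z. \<Sum>i\<in>I. \<Sum>j\<in>J. f i j z)"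
    by (rule sum.swap)
  finally show ?thesis .
qed

lemma proots_char_poly_commuting_sum:
  fixes A B :: "complex mat"
  assumes carr: "A \<in> carrier_mat n n" "B \<in> carrier_mat n n"
    "\<And>i. i \<in> I \<Longrightarrow> P i \<in> carrier_mat n n" "\<And>j. j \<in> J \<Longrightarrow> Q j \<in> carrier_mat n n"
    and AP: "\<And>i. i \<in> I \<Longrightarrow> A * P i = \<alpha> i \<cdot>\<^sub>m P i"
    and BP: "\<And>i. i \<in> I \<Longrightarrow> B * P i = P i * B"
    and BQ: "\<And>j. j \<in> J \<Longrightarrow> B * Q j = \<beta> j \<cdot>\<^sub>m Q j"
    and sumP: "\<And>x y. x < n \<Longrightarrow> y < n \<Longrightarrow> (\<Sum>i\<in>I. P i $$ (x, y)) = (if x = y then 1 else 0)"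
    and sumQ: "\<And>x y. x < n \<Longrightarrow> y < n \<Longrightarrow> (\<Sum>j\<in>J. Q j $$ (x, y)) = (if x = y then 1 else 0)"
    and tr: "\<And>i j. i \<in> I \<Longrightarrow> j \<in> J \<Longrightarrow> mat_trace (P i * Q j) = of_nat (m i j)"
  shows "proots (char_poly (A + B)) = (\<Sum>i\<in>I. \<Sum>j\<in>J. replicate_mset (m i j) (\<alpha> i + \<beta> j))"
proof (rule multiset_eq_if_power_sums_eq)
  fix k
  let ?M = "A + B"
  have M: "?M \<in> carrier_mat n n" using carr by simp
  have PQ: "P i * Q j \<in> carrier_mat n n" if "i \<in> I" "j \<in> J" for i j
    using carr(3)[of i] carr(4)[of j] that by (intro mult_carrier_mat[of _ n n]) auto
  have eigen: "?M * (P i * Q j) = (\<alpha> i + \<beta> j) \<cdot>\<^sub>m (P i * Q j)" if ij: "i \<in> I" "j \<in> J" for i j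
  proof -
    note c = carr(1,2) carr(3)[OF ij(1)] carr(4)[OF ij(2)]
    have "?M * (P i * Q j) = A * (P i * Q j) + B * (P i * Q j)"
      using c by (intro add_mult_distrib_mat) auto
    also have "A * (P i * Q j) = \<alpha> i \<cdot>\<^sub>m (P i * Q j)"
      using assoc_mult_mat[OF c(1,3,4)] mult_smult_assoc_mat[OF c(3,4)] AP[OF ij(1)] by simp
    also have "B * (P i * Q j) = \<beta> j \<cdot>\<^sub>m (P i * Q j)"
      using assoc_mult_mat[OF c(2,3,4)] assoc_mult_mat[OF c(3,2,4)] mult_smult_distrib[OF c(3,4)]
        BP[OF ij(1)] BQ[OF ij(2)] by simp
    finally show ?thesis by (simp add: add_smult_distrib_right_mat[OF PQ[OF ij]])
  qed
  have pow: "(?M ^\<^sub>m k) $$ (x, y) = (\<Sum>i\<in>I. \<Sum>j\<in>J. (\<alpha> i + \<beta> j) ^ k * (P i * Q j) $$ (x, y))"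
    if xy: "x < n" "y < n" for x y
    using xy
  proof (induction k arbitrary: x y)
    case 0
    have "(\<Sum>i\<in>I. \<Sum>j\<in>J. (P i * Q j) $$ (x, y)) =
        (\<Sum>i\<in>I. \<Sum>j\<in>J. \<Sum>z<n. P i $$ (x, z) * Q j $$ (z, y))"
      using 0 carr by (intro sum.cong refl mult_mat_index_sum) auto
    also have "\<dots> = (\<Sum>z<n. \<Sum>i\<in>I. \<Sum>j\<in>J. P i $$ (x, z) * Q j $$ (z, y))"
      by (rule sum_rotate)
    also have "\<dots> = (\<Sum>z<n. (\<Sum>i\<in>I. P i $$ (x, z)) * (\<Sum>j\<in>J. Q j $$ (z, y)))"
      by (simp add: sum_product)
    also have "\<dots> = (\<Sum>z<n. if z = x then (if x = y then 1 else 0) else 0)"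
      using 0 by (intro sum.cong refl) (auto simp: sumP sumQ)
    also have "\<dots> = (if x = y then 1 else 0)" using 0 by simp
    finally show ?case using 0 carr by simp
  next
    case (Suc k)
    have "?M ^\<^sub>m Suc k = ?M * ?M ^\<^sub>m k"
    proof (induction k)
      case 0
      then show ?case using carr by simp
    next
      case (Suc k)
      then show ?case using assoc_mult_mat[OF M pow_carrier_mat[OF M, of k] M] by simp
    qed
    then have "(?M ^\<^sub>m Suc k) $$ (x, y) = (\<Sum>z<n. ?M $$ (x, z) * (?M ^\<^sub>m k) $$ (z, y))"
      using mult_mat_index_sum[OF M pow_carrier_mat[OF M]] Suc.prems by simp
    also have "\<dots> = (\<Sum>z<n. \<Sum>i\<in>I. \<Sum>j\<in>J. (\<alpha> i + \<beta> j) ^ k * (?M $$ (x, z) * (P i * Q j) $$ (z, y)))"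
      using Suc by (intro sum.cong refl) (simp add: sum_distrib_left mult_ac)
    also have "\<dots> = (\<Sum>i\<in>I. \<Sum>j\<in>J. (\<alpha> i + \<beta> j) ^ k * (\<Sum>z<n. ?M $$ (x, z) * (P i * Q j) $$ (z, y)))"
      unfolding sum_distrib_left by (rule sum_rotate[symmetric])
    also have "\<dots> = (\<Sum>i\<in>I. \<Sum>j\<in>J. (\<alpha> i + \<beta> j) ^ k * (?M * (P i * Q j)) $$ (x, y))"
      using Suc.prems by (simp add: mult_mat_index_sum[OF M PQ])
    also have "\<dots> = (\<Sum>i\<in>I. \<Sum>j\<in>J. (\<alpha> i + \<beta> j) ^ Suc k * (P i * Q j) $$ (x, y))"
    proof (intro sum.cong refl)
      fix i j assume "i \<in> I" "j \<in> J"
      then show "(\<alpha> i + \<beta> j) ^ k * (?M * (P i * Q j)) $$ (x, y) =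
          (\<alpha> i + \<beta> j) ^ Suc k * (P i * Q j) $$ (x, y)"
        using PQ[of i j] Suc.prems by (simp only: eigen) (auto simp del: index_mult_mat)
    qed
    finally show ?case .
  qed
  have "mat_trace (?M ^\<^sub>m k) = (\<Sum>i\<in>I. \<Sum>j\<in>J. (\<alpha> i + \<beta> j) ^ k * mat_trace (P i * Q j))"
  proof -
    have "mat_trace (?M ^\<^sub>m k) = (\<Sum>x<n. \<Sum>i\<in>I. \<Sum>j\<in>J. (\<alpha> i + \<beta> j) ^ k * (P i * Q j) $$ (x, x))"
      using carr pow by (simp add: mat_trace_def)
    also have "\<dots> = (\<Sum>i\<in>I. \<Sum>j\<in>J. (\<alpha> i + \<beta> j) ^ k * (\<Sum>x<n. (P i * Q j) $$ (x, x)))"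
      unfolding sum_distrib_left by (rule sum_rotate[symmetric])
    also have "\<dots> = (\<Sum>i\<in>I. \<Sum>j\<in>J. (\<alpha> i + \<beta> j) ^ k * mat_trace (P i * Q j))"
    proof (intro sum.cong refl)
      fix i j assume "i \<in> I" "j \<in> J"
      then have "dim_row (P i) = n" using carr(3) by auto
      then show "(\<alpha> i + \<beta> j) ^ k * (\<Sum>x<n. (P i * Q j) $$ (x, x)) = (\<alpha> i + \<beta> j) ^ k * mat_trace (P i * Q j)"
        by (simp add: mat_trace_def)
    qed
    finally show ?thesis .
  qed
  also have "\<dots> = (\<Sum>i\<in>I. \<Sum>j\<in>J. of_nat (m i j) * (\<alpha> i + \<beta> j) ^ k)"
    by (intro sum.cong refl) (simp add: tr)
  also have "\<dots> = (\<Sum>x\<in>#(\<Sum>i\<in>I. \<Sum>j\<in>J. replicate_mset (m i j) (\<alpha> i + \<beta> j)). x ^ k)"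
  proof -
    have image_sum: "(\<Sum>x\<in>#(\<Sum>i\<in>K. g i). x ^ k) = (\<Sum>i\<in>K. \<Sum>x\<in>#g i. x ^ k)"
      for K :: "'x set" and g :: "'x \<Rightarrow> complex multiset"
      by (induction K rule: infinite_finite_induct) auto
    show ?thesis by (simp add: image_sum)
  qed
  finally show "(\<Sum>x\<in>#proots (char_poly ?M). x ^ k) =
      (\<Sum>x\<in>#(\<Sum>i\<in>I. \<Sum>j\<in>J. replicate_mset (m i j) (\<alpha> i + \<beta> j)). x ^ k)"
    using power_sum_proots_char_poly[OF M] by simp
qed

definition ker_mat :: "'a list \<Rightarrow> ('a \<Rightarrow> 'a \<Rightarrow> 'b) \<Rightarrow> 'b mat" where
  "ker_mat xs g = mat (length xs) (length xs) (\<lambda>(i, j). g (xs ! i) (xs ! j))"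

lemma ker_mat_carrier [simp]: "ker_mat xs g \<in> carrier_mat (length xs) (length xs)"
  by (simp add: ker_mat_def)

lemma sum_nth_distinct:
  assumes "distinct xs"
  shows "(\<Sum>k<length xs. g (xs ! k)) = (\<Sum>z\<in>set xs. g z)"
  using bij_betw_nth[OF assms refl refl] by (rule sum.reindex_bij_betw)

lemma ker_mat_mult:
  assumes "distinct xs"
  shows "ker_mat xs g * ker_mat xs h = ker_mat xs (\<lambda>x y. \<Sum>z\<in>set xs. g x z * h z y)"
proof (rule eq_matI)
  fix i j
  assume "i < dim_row (ker_mat xs (\<lambda>x y. \<Sum>z\<in>set xs. g x z * h z y))"
    and "j < dim_col (ker_mat xs (\<lambda>x y. \<Sum>z\<in>set xs. g x z * h z y))"
  then have ij: "i < length xs" "j < length xs" by (simp_all add: ker_mat_def)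
  have "(ker_mat xs g * ker_mat xs h) $$ (i, j) = (\<Sum>k<length xs. g (xs ! i) (xs ! k) * h (xs ! k) (xs ! j))"
    unfolding mult_mat_index_sum[OF ker_mat_carrier ker_mat_carrier ij]
    using ij by (intro sum.cong refl) (simp add: ker_mat_def)
  also have "\<dots> = (\<Sum>z\<in>set xs. g (xs ! i) z * h z (xs ! j))"
    by (rule sum_nth_distinct[OF assms])
  finally show "(ker_mat xs g * ker_mat xs h) $$ (i, j) =
      ker_mat xs (\<lambda>x y. \<Sum>z\<in>set xs. g x z * h z y) $$ (i, j)"
    using ij by (simp add: ker_mat_def)
qed (simp_all add: ker_mat_def)

lemma ker_mat_cong:
  assumes "\<And>x y. x \<in> set xs \<Longrightarrow> y \<in> set xs \<Longrightarrow> g x y = h x y"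
  shows "ker_mat xs g = ker_mat xs h"
  using assms by (auto simp: ker_mat_def intro!: eq_matI)

lemma mat_trace_ker_mat:
  assumes "distinct xs"
  shows "mat_trace (ker_mat xs g) = (\<Sum>x\<in>set xs. g x x)"
  using sum_nth_distinct[OF assms, of "\<lambda>x. g x x"] by (simp add: mat_trace_def ker_mat_def)

section \<open>The code of a family of Sudoku Latin squares\<close>

lemma sum_of_bool_mult:
  fixes g :: "'a \<Rightarrow> 'b::semiring_1"
  assumes "finite S" and "\<And>z. z \<in> S \<Longrightarrow> T z \<Longrightarrow> g z = k"
  shows "(\<Sum>z\<in>S. g z * of_bool (T z)) = k * of_nat (card {z \<in> S. T z})"
proof -
  have "(\<Sum>z\<in>S. g z * of_bool (T z)) = (\<Sum>z\<in>{z \<in> S. T z}. k)"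
    using assms by (intro sum.mono_neutral_cong_right) auto
  then show ?thesis by (simp add: mult.commute mult_of_nat_commute)
qed

lemma sum_of_bool:
  "finite S \<Longrightarrow> (\<Sum>z\<in>S. of_bool (T z) :: 'b::semiring_1) = of_nat (card {z \<in> S. T z})"
  using sum_of_bool_mult[of S T "\<lambda>_. 1" 1] by simp

lemma diff_one_div_eq_iff:
  assumes "q > 0" "a \<ge> (1::nat)"
  shows "(a - 1) div q = i \<longleftrightarrow> i * q + 1 \<le> a \<and> a \<le> Suc i * q"
proof -
  have "(a - 1) div q = i \<longleftrightarrow> i \<le> (a - 1) div q \<and> (a - 1) div q < Suc i" by linarith
  also have "\<dots> \<longleftrightarrow> i * q \<le> a - 1 \<and> a - 1 < Suc i * q"
    using assms by (simp only: less_eq_div_iff_mult_less_eq div_less_iff_less_mult)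
  also have "\<dots> \<longleftrightarrow> i * q + 1 \<le> a \<and> a \<le> Suc i * q"
    using assms by linarith
  finally show ?thesis .
qed

lemma mem_block_iff:
  assumes "q \<ge> 1" "r \<ge> 1" "a \<ge> 1" "b \<ge> 1" "i \<ge> 1" "j \<ge> 1"
  shows "(a, b) \<in> block q r i j \<longleftrightarrow> (a - 1) div q = i - 1 \<and> (b - 1) div r = j - 1"
  using assms diff_one_div_eq_iff[of q a "i - 1"] diff_one_div_eq_iff[of r b "j - 1"]
  by (auto simp: block_def)

lemma card_diff_one_div_eq:
  assumes "r > 0" "j < (q::nat)"
  shows "card {v \<in> {1..q * r}. (v - 1) div r = j} = r"
proof -
  have "Suc j * r \<le> q * r" using assms by (intro mult_le_mono1) simp
  have iff: "v \<in> {1..q * r} \<and> (v - 1) div r = j \<longleftrightarrow> v \<in> {j * r + 1..Suc j * r}" for v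
  proof (cases "v \<ge> 1")
    case True
    then show ?thesis
      unfolding diff_one_div_eq_iff[OF assms(1) True] atLeastAtMost_iff
      using \<open>Suc j * r \<le> q * r\<close> by linarith
  qed simp
  have "{v \<in> {1..q * r}. (v - 1) div r = j} = {j * r + 1..Suc j * r}"
    by (intro equalityI subsetI) (simp_all only: mem_Collect_eq iff)
  then show ?thesis by simp
qed

lemma latin_square_row_inj:
  assumes "latin_square n L" "a \<in> {1..n}" "b \<in> {1..n}" "b' \<in> {1..n}" "L a b = L a b'"
  shows "b = b'"
proof -
  note latin = assms(1)[unfolded latin_square_def]
  have "L a b \<in> {1..n}"
    by (rule latin[THEN conjunct1, rule_format]) (use assms in auto)
  then have "\<exists>!y. y \<in> {1..n} \<and> L a y = L a b"
    by (rule bspec[OF bspec[OF latin[THEN conjunct2, THEN conjunct1] assms(2)]])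
  then have uniq: "\<exists>\<^sub>\<le>\<^sub>1y. y \<in> {1..n} \<and> L a y = L a b" by (simp only: ex1_iff_ex_Uniq)
  show ?thesis by (rule Uniq_D[OF uniq]) (use assms in auto)
qed

lemma latin_square_column_inj:
  assumes "latin_square n L" "a \<in> {1..n}" "a' \<in> {1..n}" "b \<in> {1..n}" "L a b = L a' b"
  shows "a = a'"
proof -
  note latin = assms(1)[unfolded latin_square_def]
  have "L a b \<in> {1..n}"
    by (rule latin[THEN conjunct1, rule_format]) (use assms in auto)
  then have "\<exists>!x. x \<in> {1..n} \<and> L x b = L a b"
    by (rule bspec[OF bspec[OF latin[THEN conjunct2, THEN conjunct2] assms(4)]])
  then have uniq: "\<exists>\<^sub>\<le>\<^sub>1x. x \<in> {1..n} \<and> L x b = L a b" by (simp only: ex1_iff_ex_Uniq)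
  show ?thesis by (rule Uniq_D[OF uniq]) (use assms in auto)
qed

locale mosls_code =
  fixes q r f :: nat and L :: "nat \<Rightarrow> nat \<Rightarrow> nat \<Rightarrow> nat"
  assumes q: "q \<ge> 1" and r: "r \<ge> 1" and mosls: "mosls q r f L"
begin

abbreviation C :: "nat list set" where "C \<equiv> code (q * r) f L"

definition band :: "nat list \<Rightarrow> nat" where "band x = (x ! 0 - 1) div q"

definition stack :: "nat list \<Rightarrow> nat" where "stack x = (x ! 1 - 1) div r"

lemma nth_codeword:
  "codeword f L a b ! 0 = a" "codeword f L a b ! 1 = b"
  "2 \<le> c \<Longrightarrow> c < f + 2 \<Longrightarrow> codeword f L a b ! c = L (c - 1) a b"
proof -
  assume c: "2 \<le> c" "c < f + 2"
  define d where "d = c - 2"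
  then have "c = Suc (Suc d)" using c by simp
  then show "codeword f L a b ! c = L (c - 1) a b"
    using c by (simp add: codeword_def del: upt_Suc)
qed (simp_all add: codeword_def)

lemma length_codeword [simp]: "length (codeword f L a b) = f + 2"
  by (simp add: codeword_def)

lemma codeE:
  assumes "x \<in> C"
  obtains a b where "x = codeword f L a b" "a \<in> {1..q * r}" "b \<in> {1..q * r}"
  using assms by (auto simp: code_def)

lemma codeword_in_C: "a \<in> {1..q * r} \<Longrightarrow> b \<in> {1..q * r} \<Longrightarrow> codeword f L a b \<in> C"
  by (auto simp: code_def)

lemma codeword_nth:
  assumes "x \<in> C"
  shows "x = codeword f L (x ! 0) (x ! 1)"
  using assms by (metis codeE nth_codeword(1,2))

lemma length_code: "x \<in> C \<Longrightarrow> length x = f + 2"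
  by (metis codeE length_codeword)

lemma finite_C [simp]: "finite C"
proof -
  have "C \<subseteq> (\<lambda>(a, b). codeword f L a b) ` ({1..q * r} \<times> {1..q * r})"
    by (auto simp: code_def)
  then show ?thesis by (rule finite_subset) simp
qed

lemma sudoku: "2 \<le> c \<Longrightarrow> c < f + 2 \<Longrightarrow> sudoku_latin_square q r (L (c - 1))"
proof -
  assume "2 \<le> c" "c < f + 2"
  then have "c - 1 \<in> {1..f}" by auto
  then show ?thesis by (rule bspec[OF mosls[unfolded mosls_def, THEN conjunct1]])
qed

lemma latin: "2 \<le> c \<Longrightarrow> c < f + 2 \<Longrightarrow> latin_square (q * r) (L (c - 1))"
  using sudoku by (simp add: sudoku_latin_square_def)

lemma nth_code_range:
  assumes x: "x \<in> C" and c: "c < f + 2"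
  shows "x ! c \<in> {1..q * r}"
proof -
  obtain a b where ab: "x = codeword f L a b" "a \<in> {1..q * r}" "b \<in> {1..q * r}"
    using x by (rule codeE)
  consider "c = 0" | "c = 1" | "2 \<le> c" by linarith
  then show ?thesis
  proof cases
    case 3
    then show ?thesis
      using latin[OF 3 c] ab nth_codeword(3)[OF 3 c] unfolding latin_square_def by simp
  qed (use ab nth_codeword in auto)
qed

lemma band_less: "x \<in> C \<Longrightarrow> band x < r"
  using nth_code_range[of x 0] q
  by (auto simp: band_def div_less_iff_less_mult less_mult_imp_div_less mult.commute)

lemma stack_less: "x \<in> C \<Longrightarrow> stack x < q"
  using nth_code_range[of x 1] r
  by (auto simp: stack_def div_less_iff_less_mult less_mult_imp_div_less mult.commute)

lemma mem_block_cell_iff: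
  assumes "x \<in> C" "i \<ge> 1" "j \<ge> 1"
  shows "(x ! 0, x ! 1) \<in> block q r i j \<longleftrightarrow> band x = i - 1 \<and> stack x = j - 1"
  using mem_block_iff[OF q r, of "x ! 0" "x ! 1" i j] assms
    nth_code_range[of x 0] nth_code_range[of x 1]
  by (auto simp: band_def stack_def)

lemma same_block_iff:
  assumes "x \<in> C" "y \<in> C"
  shows "same_block q r x y \<longleftrightarrow> band x = band y \<and> stack x = stack y"
proof
  assume "same_block q r x y"
  then show "band x = band y \<and> stack x = stack y"
    using assms mem_block_cell_iff by (auto simp: same_block_def)
next
  assume eq: "band x = band y \<and> stack x = stack y"
  let ?i = "Suc (band x)" and ?j = "Suc (stack x)"
  have "(x ! 0, x ! 1) \<in> block q r ?i ?j" "(y ! 0, y ! 1) \<in> block q r ?i ?j"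
    using mem_block_cell_iff[OF assms(1), of ?i ?j] mem_block_cell_iff[OF assms(2), of ?i ?j] eq
    by simp_all
  moreover have "?i \<in> {1..r}" "?j \<in> {1..q}"
    using band_less[OF assms(1)] stack_less[OF assms(1)] by simp_all
  ultimately show "same_block q r x y" unfolding same_block_def by blast
qed

lemma code_inj:
  assumes xy: "x \<in> C" "y \<in> C" and cd: "c < d" "d < f + 2" and eq: "x ! c = y ! c" "x ! d = y ! d"
  shows "x = y"
proof -
  obtain a b where x: "x = codeword f L a b" and ab: "a \<in> {1..q * r}" "b \<in> {1..q * r}"
    using xy(1) by (rule codeE)
  obtain a' b' where y: "y = codeword f L a' b'" and ab': "a' \<in> {1..q * r}" "b' \<in> {1..q * r}"
    using xy(2) by (rule codeE)
  have "a = a' \<and> b = b'"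
  proof (cases "2 \<le> c")
    case True
    then have "c - 1 \<in> {1..f}" "d - 1 \<in> {1..f}" "c - 1 \<noteq> d - 1" using cd by auto
    then have "orthogonal_squares (q * r) (L (c - 1)) (L (d - 1))"
      using mosls unfolding mosls_def mutually_orthogonal_def by blast
    moreover have "(L (c - 1) a b, L (d - 1) a b) = (L (c - 1) a' b', L (d - 1) a' b')"
      using True cd eq nth_codeword(3)[of c] nth_codeword(3)[of d] by (simp add: x y)
    ultimately have "(a, b) = (a', b')"
      unfolding orthogonal_squares_def by (elim inj_onD) (use ab ab' in auto)
    then show ?thesis by simp
  next
    case c: False
    then have "c = 0 \<or> c = 1" by linarith
    then show ?thesis
    proof (elim disjE)
      assume c: "c = 0"
      then have a: "a = a'" using eq nth_codeword x y by simp
      show ?thesis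
      proof (cases "2 \<le> d")
        case True
        then have "L (d - 1) a b = L (d - 1) a b'"
          using eq(2) cd a nth_codeword(3)[of d] by (simp add: x y)
        then have "b = b'"
          using latin_square_row_inj[OF latin[OF True cd(2)]] ab ab' by blast
        then show ?thesis using a by simp
      next
        case False
        then have "d = 1" using cd by linarith
        then show ?thesis using a eq nth_codeword x y by simp
      qed
    next
      assume c: "c = 1"
      then have b: "b = b'" using eq nth_codeword x y by simp
      have d: "2 \<le> d" using c cd by simp
      then have "L (d - 1) a b = L (d - 1) a' b"
        using eq(2) cd b nth_codeword(3)[of d] by (simp add: x y)
      then have "a = a'"
        using latin_square_column_inj[OF latin[OF d cd(2)]] ab ab' by blast
      then show ?thesis using b by simp
    qed
  qed
  then show ?thesis using x y by simp
qed

lemma code_eq: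
  assumes "x \<in> C" "y \<in> C" "c \<noteq> d" "c < f + 2" "d < f + 2" "x ! c = y ! c" "x ! d = y ! d"
  shows "x = y"
proof (cases "c < d")
  case True
  then show ?thesis using code_inj assms by blast
next
  case False
  then have "d < c" using assms(3) by simp
  then show ?thesis using code_inj assms by blast
qed

lemma card_C: "card C = (q * r) ^ 2"
proof -
  have "C = (\<lambda>(a, b). codeword f L a b) ` ({1..q * r} \<times> {1..q * r})"
    unfolding code_def by force
  moreover have "inj_on (\<lambda>(a, b). codeword f L a b) ({1..q * r} \<times> {1..q * r})"
  proof (rule inj_onI, clarify)
    fix a b a' b' assume "codeword f L a b = codeword f L a' b'"
    then show "a = a' \<and> b = b'" by (metis nth_codeword(1,2))
  qed
  ultimately show ?thesis by (simp add: card_image power2_eq_square)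
qed

lemma bij_betw_coordinates:
  assumes "c \<noteq> d" "c < f + 2" "d < f + 2"
  shows "bij_betw (\<lambda>x. (x ! c, x ! d)) C ({1..q * r} \<times> {1..q * r})"
proof -
  have inj: "inj_on (\<lambda>x. (x ! c, x ! d)) C"
    using assms code_eq by (auto intro!: inj_onI)
  moreover have "(\<lambda>x. (x ! c, x ! d)) ` C = {1..q * r} \<times> {1..q * r}"
    using nth_code_range assms
    by (intro card_subset_eq) (auto simp: card_image[OF inj] card_C power2_eq_square)
  ultimately show ?thesis by (simp add: bij_betw_def)
qed

lemma card_code_pair:
  assumes "c \<noteq> d" "c < f + 2" "d < f + 2"
  shows "card {x \<in> C. Q (x ! c) (x ! d)} = card {(u, v) \<in> {1..q * r} \<times> {1..q * r}. Q u v}"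
proof -
  let ?g = "\<lambda>x. (x ! c, x ! d)"
  have inj: "inj_on ?g C" and im: "?g ` C = {1..q * r} \<times> {1..q * r}"
    using bij_betw_coordinates[OF assms] by (auto simp: bij_betw_def)
  have "?g ` {x \<in> C. Q (x ! c) (x ! d)} = {(u, v) \<in> ?g ` C. Q u v}" by auto
  moreover have "inj_on ?g {x \<in> C. Q (x ! c) (x ! d)}"
    using inj by (rule inj_on_subset) auto
  ultimately show ?thesis
    unfolding im by (metis (no_types, lifting) card_image)
qed

lemma card_code_pair_rect:
  assumes "c \<noteq> d" "c < f + 2" "d < f + 2"
  shows "card {x \<in> C. Q (x ! c) \<and> Q' (x ! d)} =
    card {u \<in> {1..q * r}. Q u} * card {v \<in> {1..q * r}. Q' v}"
proof -
  have rect: "{(u, v) \<in> {1..q * r} \<times> {1..q * r}. Q u \<and> Q' v} =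
      {u \<in> {1..q * r}. Q u} \<times> {v \<in> {1..q * r}. Q' v}" by auto
  show ?thesis
    unfolding card_code_pair[OF assms, of "\<lambda>u v. Q u \<and> Q' v"] rect
    by (rule card_cartesian_product)
qed

lemma card_eq_one_interval: "u \<in> {1..k} \<Longrightarrow> card {v \<in> {1..k}. v = (u::nat)} = 1"
  by (auto simp: card_1_singleton_iff)

lemma card_agree_two:
  assumes "c \<noteq> d" "c < f + 2" "d < f + 2" "x \<in> C" "y \<in> C"
  shows "card {z \<in> C. z ! c = x ! c \<and> z ! d = y ! d} = 1"
  using card_code_pair_rect[OF assms(1-3), of "\<lambda>u. u = x ! c" "\<lambda>v. v = y ! d"]
    card_eq_one_interval[OF nth_code_range[OF assms(4,2)]]
    card_eq_one_interval[OF nth_code_range[OF assms(5,3)]] by simp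

lemma card_agree_one:
  assumes "c < f + 2" "x \<in> C"
  shows "card {z \<in> C. z ! c = x ! c} = q * r"
proof -
  obtain d where d: "c \<noteq> d" "d < f + 2"
    using that[of "if c = 0 then 1 else 0"] by auto
  have "card {v \<in> {1..q * r}. True} = q * r"
    by (simp only: simp_thms Collect_mem_eq card_atLeastAtMost diff_Suc_1 Suc_eq_plus1[symmetric])
  then show ?thesis
    using card_code_pair_rect[OF d(1) assms(1) d(2), of "\<lambda>u. u = x ! c" "\<lambda>_. True"]
      card_eq_one_interval[OF nth_code_range[OF assms(2,1)]] by simp
qed

lemma card_same_block:
  assumes "x \<in> C"
  shows "card {z \<in> C. band z = band x \<and> stack z = stack x} = q * r"
  using card_code_pair_rect[of 0 1 "\<lambda>u. (u - 1) div q = band x" "\<lambda>v. (v - 1) div r = stack x"]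
    card_diff_one_div_eq[of q "band x" r] card_diff_one_div_eq[of r "stack x" q]
    band_less[OF assms] stack_less[OF assms] q r
  by (simp add: band_def stack_def mult.commute)

lemma card_same_row_stack:
  assumes "x \<in> C"
  shows "card {z \<in> C. z ! 0 = x ! 0 \<and> stack z = stack x} = r"
  using card_code_pair_rect[of 0 1 "\<lambda>u. u = x ! 0" "\<lambda>v. (v - 1) div r = stack x"]
    card_eq_one_interval[OF nth_code_range[OF assms, of 0]] card_diff_one_div_eq[of r "stack x" q]
    stack_less[OF assms] q r
  by (simp add: stack_def)

lemma card_same_column_band:
  assumes "x \<in> C"
  shows "card {z \<in> C. z ! 1 = x ! 1 \<and> band z = band x} = q"
  using card_code_pair_rect[of 1 0 "\<lambda>v. v = x ! 1" "\<lambda>u. (u - 1) div q = band x"]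
    card_eq_one_interval[OF nth_code_range[OF assms, of 1]] card_diff_one_div_eq[of q "band x" r]
    band_less[OF assms] q r
  by (simp add: band_def mult.commute)

lemma same_block_symbol_eq:
  assumes xy: "x \<in> C" "y \<in> C" and c: "2 \<le> c" "c < f + 2"
    and eq: "band x = band y" "stack x = stack y" "x ! c = y ! c"
  shows "x = y"
proof -
  let ?B = "block q r (Suc (band x)) (Suc (stack x))"
  note sudoku_c = sudoku[OF c, unfolded sudoku_latin_square_def, THEN conjunct2]
  have b: "Suc (band x) \<in> {1..r}" "Suc (stack x) \<in> {1..q}"
    using band_less[OF xy(1)] stack_less[OF xy(1)] by simp_all
  have "\<exists>!p. p \<in> ?B \<and> L (c - 1) (fst p) (snd p) = x ! c"
    using bspec[OF bspec[OF bspec[OF sudoku_c b(1)] b(2)] nth_code_range[OF xy(1) c(2)]] .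
  then have uniq: "\<exists>\<^sub>\<le>\<^sub>1p. p \<in> ?B \<and> L (c - 1) (fst p) (snd p) = x ! c"
    by (simp only: ex1_iff_ex_Uniq)
  have symbol: "L (c - 1) (z ! 0) (z ! 1) = z ! c" if "z \<in> C" for z
    using codeword_nth[OF that] nth_codeword(3)[OF c, of "z ! 0" "z ! 1"] by simp
  have "(x ! 0, x ! 1) = (y ! 0, y ! 1)"
    by (rule Uniq_D[OF uniq])
      (use xy eq symbol mem_block_cell_iff[of x "Suc (band x)" "Suc (stack x)"]
        mem_block_cell_iff[of y "Suc (band x)" "Suc (stack x)"] in simp_all)
  then show ?thesis
    using codeword_nth[OF xy(1)] codeword_nth[OF xy(2)] by simp
qed

text \<open>
  Each \<open>x ! c\<close> with \<open>c \<ge> 2\<close> recurs on the line \<open>u\<close>: outside the positions \<open>S\<close>, as these share a block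
  with \<open>x\<close>, and at different positions for different \<open>c\<close>, by orthogonality.
\<close>
lemma squares_bound:
  assumes x: "x \<in> C" and c: "c0 < 2" "c1 < 2" "c0 \<noteq> c1"
    and u: "u \<in> {1..q * r}" "u \<noteq> x ! c0" and S: "S \<subseteq> {1..q * r}"
    and same: "\<And>z. z \<in> C \<Longrightarrow> z ! c0 = u \<Longrightarrow> z ! c1 \<in> S \<Longrightarrow> band z = band x \<and> stack z = stack x"
  shows "f + card S \<le> q * r"
proof -
  have "\<exists>z. z \<in> C \<and> z ! c0 = u \<and> z ! c = x ! c" if d: "c \<in> {2..<f + 2}" for c
  proof -
    have "(u, x ! c) \<in> (\<lambda>z. (z ! c0, z ! c)) ` C"
      using bij_betw_coordinates[of c0 c] nth_code_range[OF x, of c] d c u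
      by (auto simp: bij_betw_def)
    then show ?thesis by auto
  qed
  then obtain z where z: "\<And>c. c \<in> {2..<f + 2} \<Longrightarrow> z c \<in> C \<and> z c ! c0 = u \<and> z c ! c = x ! c"
    by metis
  have "inj_on (\<lambda>c. z c ! c1) {2..<f + 2}"
  proof (rule inj_onI, rule ccontr)
    fix d e assume de: "d \<in> {2..<f + 2}" "e \<in> {2..<f + 2}" "z d ! c1 = z e ! c1" "d \<noteq> e"
    then have "z d = z e"
      using c z[of d] z[of e] code_eq[of "z d" "z e" c0 c1] by auto
    then have "z d = x"
      using de x z[of d] z[of e] code_eq[of "z d" x d e] by auto
    then show False using z[OF de(1)] u(2) by simp
  qed
  moreover have "z d ! c1 \<in> {1..q * r} - S" if d: "d \<in> {2..<f + 2}" for d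
  proof -
    have "z d ! c1 \<notin> S"
    proof
      assume "z d ! c1 \<in> S"
      then have "z d = x"
        using same z[OF d] x d same_block_symbol_eq[of "z d" x d] by auto
      then show False using z[OF d] u(2) by simp
    qed
    then show ?thesis using nth_code_range[of "z d" c1] z[OF d] c by auto
  qed
  ultimately have "card {2..<f + 2} \<le> card ({1..q * r} - S)"
    by (intro card_inj_on_le[of "\<lambda>c. z c ! c1"]) auto
  moreover have "finite S" using S finite_subset by blast
  ultimately have "f \<le> q * r - card S" using S by (simp add: card_Diff_subset)
  moreover have "card S \<le> q * r" using card_mono[OF _ S] by simp
  ultimately show ?thesis by linarith
qed

lemma squares_bound_rows:
  assumes "q > 1"
  shows "f + r \<le> q * r"
proof -
  have n: "2 \<le> q * r" "r \<le> q * r" using assms r mult_le_mono[of 2 q 1 r] by simp_all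
  let ?x = "codeword f L 2 1"
  have "?x \<in> C" using n q r by (intro codeword_in_C) auto
  then have "f + card {1..r} \<le> q * r"
  proof (rule squares_bound[of _ 0 1 1])
    fix z assume "z ! 0 = 1" "z ! 1 \<in> {1..r}"
    then show "band z = band ?x \<and> stack z = stack ?x"
      using assms r by (auto simp: band_def stack_def nth_codeword[unfolded One_nat_def] div_eq_0_iff)
  qed (use n q r in \<open>auto simp: nth_codeword[unfolded One_nat_def]\<close>)
  then show ?thesis by simp
qed

lemma squares_bound_columns:
  assumes "r > 1"
  shows "f + q \<le> q * r"
proof -
  have n: "2 \<le> q * r" "q \<le> q * r" using assms q mult_le_mono[of 1 q 2 r] by simp_all
  let ?x = "codeword f L 1 2"
  have "?x \<in> C" using n q r by (intro codeword_in_C) auto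
  then have "f + card {1..q} \<le> q * r"
  proof (rule squares_bound[of _ 1 0 1])
    fix z assume "z ! 1 = 1" "z ! 0 \<in> {1..q}"
    then show "band z = band ?x \<and> stack z = stack ?x"
      using assms q by (auto simp: band_def stack_def nth_codeword[unfolded One_nat_def] div_eq_0_iff)
  qed (use n q r in \<open>auto simp: nth_codeword[unfolded One_nat_def]\<close>)
  then show ?thesis by simp
qed

subsection \<open>Kernels on the code\<close>

definition id_ker :: "nat list \<Rightarrow> nat list \<Rightarrow> complex" where
  "id_ker x y = of_bool (x = y)"

definition row_ker :: "nat list \<Rightarrow> nat list \<Rightarrow> complex" where
  "row_ker x y = of_bool (x ! 0 = y ! 0 \<and> stack x = stack y)"

definition col_ker :: "nat list \<Rightarrow> nat list \<Rightarrow> complex" where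
  "col_ker x y = of_bool (x ! 1 = y ! 1 \<and> band x = band y)"

definition block_ker :: "nat list \<Rightarrow> nat list \<Rightarrow> complex" where
  "block_ker x y = of_bool (band x = band y \<and> stack x = stack y)"

definition agree_ker :: "nat list \<Rightarrow> nat list \<Rightarrow> complex" where
  "agree_ker x y = (\<Sum>c<f + 2. of_bool (x ! c = y ! c))"

definition A_ker :: "nat list \<Rightarrow> nat list \<Rightarrow> complex" where
  "A_ker x y = of_bool (hamming_dist x y = f + 1)"

definition B_ker :: "nat list \<Rightarrow> nat list \<Rightarrow> complex" where
  "B_ker x y = of_bool (same_block q r x y \<and> x ! 0 \<noteq> y ! 0 \<and> x ! 1 \<noteq> y ! 1)"

lemma ker_sym:
  "id_ker x y = id_ker y x" "row_ker x y = row_ker y x" "col_ker x y = col_ker y x"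
  "block_ker x y = block_ker y x" "agree_ker x y = agree_ker y x"
  by (auto simp: id_ker_def row_ker_def col_ker_def block_ker_def agree_ker_def eq_commute)

lemma A_ker_eq:
  assumes "x \<in> C" "y \<in> C"
  shows "A_ker x y = agree_ker x y - of_nat (f + 2) * id_ker x y"
proof -
  let ?E = "{c \<in> {..<f + 2}. x ! c = y ! c}" and ?D = "{c. c < length x \<and> x ! c \<noteq> y ! c}"
  define e where "e = card ?E"
  have agree: "agree_ker x y = of_nat e"
    by (simp only: agree_ker_def sum_of_bool finite_lessThan e_def)
  have D: "?D = {..<f + 2} - ?E" using length_code[OF assms(1)] by auto
  have "card ?E \<le> card {..<f + 2}" by (rule card_mono) auto
  then have e: "e \<le> f + 2" by (simp only: e_def card_lessThan)
  have "card ?D = card {..<f + 2} - card ?E"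
    unfolding D by (intro card_Diff_subset) auto
  then have "hamming_dist x y = f + 2 - e"
    by (simp only: hamming_dist_def e_def card_lessThan)
  then have A: "A_ker x y = of_bool (e = 1)"
    using e by (auto simp: A_ker_def)
  show ?thesis
  proof (cases "x = y")
    case True
    then have "e = f + 2" by (simp add: e_def)
    then show ?thesis unfolding A agree using True by (simp add: id_ker_def)
  next
    case False
    have "e \<le> Suc 0"
      using code_eq[OF assms] False unfolding e_def by (intro card_le_Suc0_iff_eq[THEN iffD2]) auto
    then show ?thesis
      unfolding A agree using False by (cases e) (auto simp: id_ker_def)
  qed
qed

lemma B_ker_eq:
  assumes "x \<in> C" "y \<in> C"
  shows "B_ker x y = block_ker x y - row_ker x y - col_ker x y + id_ker x y"
proof (cases "x = y")
  case False
  then have "\<not> (x ! 0 = y ! 0 \<and> x ! 1 = y ! 1)"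
    using code_eq[OF assms, of 0 1] by auto
  with False show ?thesis
    by (auto simp: B_ker_def same_block_iff[OF assms] block_ker_def row_ker_def col_ker_def
        id_ker_def band_def stack_def)
qed (simp add: B_ker_def block_ker_def row_ker_def col_ker_def id_ker_def)

lemma sum_id_ker:
  assumes "y \<in> C"
  shows "(\<Sum>z\<in>C. g z * id_ker z y) = g y" "(\<Sum>z\<in>C. id_ker y z * g z) = g y"
proof -
  have "(\<Sum>z\<in>C. g z * id_ker z y) = (\<Sum>z\<in>C. if z = y then g z else 0)"
    by (intro sum.cong refl) (simp add: id_ker_def)
  then show "(\<Sum>z\<in>C. g z * id_ker z y) = g y" using assms by simp
  then show "(\<Sum>z\<in>C. id_ker y z * g z) = g y"
    by (simp only: ker_sym(1)[of y] mult.commute[of "id_ker _ _"])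
qed

lemma ker_sums:
  assumes "x \<in> C"
  shows "(\<Sum>z\<in>C. id_ker z x) = 1" "(\<Sum>z\<in>C. row_ker z x) = of_nat r"
    "(\<Sum>z\<in>C. col_ker z x) = of_nat q" "(\<Sum>z\<in>C. block_ker z x) = of_nat (q * r)"
    "(\<Sum>z\<in>C. agree_ker z x) = of_nat (f + 2) * of_nat (q * r)"
    "(\<Sum>z\<in>C. B_ker z x) = (of_nat q - 1) * (of_nat r - 1)"
    "(\<Sum>z\<in>C. A_ker z x) = of_nat (f + 2) * (of_nat (q * r) - 1)"
proof -
  show id: "(\<Sum>z\<in>C. id_ker z x) = 1" using sum_id_ker(1)[OF assms, of "\<lambda>_. 1"] by simp
  show row: "(\<Sum>z\<in>C. row_ker z x) = of_nat r"
    by (simp only: row_ker_def sum_of_bool finite_C card_same_row_stack[OF assms])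
  show col: "(\<Sum>z\<in>C. col_ker z x) = of_nat q"
    by (simp only: col_ker_def sum_of_bool finite_C card_same_column_band[OF assms])
  show block: "(\<Sum>z\<in>C. block_ker z x) = of_nat (q * r)"
    by (simp only: block_ker_def sum_of_bool finite_C card_same_block[OF assms])
  have "(\<Sum>z\<in>C. agree_ker z x) = (\<Sum>c<f + 2. \<Sum>z\<in>C. of_bool (z ! c = x ! c))"
    unfolding agree_ker_def by (rule sum.swap)
  also have "\<dots> = (\<Sum>c<f + 2. of_nat (q * r))"
    by (intro sum.cong refl) (simp only: sum_of_bool finite_C card_agree_one[OF _ assms] lessThan_iff)
  finally show agree: "(\<Sum>z\<in>C. agree_ker z x) = of_nat (f + 2) * of_nat (q * r)"
    by (simp only: sum_constant card_lessThan)
  have "(\<Sum>z\<in>C. B_ker z x) =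
      (\<Sum>z\<in>C. block_ker z x) - (\<Sum>z\<in>C. row_ker z x) - (\<Sum>z\<in>C. col_ker z x) + (\<Sum>z\<in>C. id_ker z x)"
    unfolding sum.distrib[symmetric] sum_subtractf[symmetric]
    by (intro sum.cong refl B_ker_eq assms)
  then show "(\<Sum>z\<in>C. B_ker z x) = (of_nat q - 1) * (of_nat r - 1)"
    unfolding id row col block by (simp add: algebra_simps)
  have "(\<Sum>z\<in>C. A_ker z x) = (\<Sum>z\<in>C. agree_ker z x) - of_nat (f + 2) * (\<Sum>z\<in>C. id_ker z x)"
    unfolding sum_distrib_left sum_subtractf[symmetric]
    by (intro sum.cong refl A_ker_eq assms)
  then show "(\<Sum>z\<in>C. A_ker z x) = of_nat (f + 2) * (of_nat (q * r) - 1)"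
    unfolding id agree by (simp add: algebra_simps)
qed

lemma A_ker_sym: "x \<in> C \<Longrightarrow> y \<in> C \<Longrightarrow> A_ker x y = A_ker y x"
  using A_ker_eq[of x y] A_ker_eq[of y x] ker_sym by metis

lemma B_ker_sym: "x \<in> C \<Longrightarrow> y \<in> C \<Longrightarrow> B_ker x y = B_ker y x"
  using B_ker_eq[of x y] B_ker_eq[of y x] ker_sym by metis

lemma agree_ker_mult:
  assumes "x \<in> C" "y \<in> C"
  shows "(\<Sum>z\<in>C. agree_ker x z * agree_ker z y) =
    of_nat (q * r) * agree_ker x y + of_nat (f + 2) * of_nat (f + 1)"
proof -
  let ?n = "of_nat (q * r) :: complex"
  have inner: "(\<Sum>z\<in>C. of_bool (x ! c = z ! c) * of_bool (z ! d = y ! d)) =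
      (if c = d then ?n * of_bool (x ! c = y ! c) - 1 else 0) + 1"
    if "c < f + 2" "d < f + 2" for c d
  proof -
    have eq: "(\<Sum>z\<in>C. of_bool (x ! c = z ! c) * of_bool (z ! d = y ! d)) =
        (of_nat (card {z \<in> C. z ! c = x ! c \<and> z ! d = y ! d}) :: complex)"
      by (simp only: of_bool_conj[symmetric] sum_of_bool finite_C eq_commute[of "x ! c"])
    show ?thesis
    proof (cases "c = d")
      case False
      then show ?thesis unfolding eq using card_agree_two[OF False that assms] by simp
    next
      case [simp]: True
      show ?thesis
      proof (cases "x ! d = y ! d")
        case e: True
        then show ?thesis unfolding eq using card_agree_one[OF that(2) assms(2)] by simp
      next
        case e: False
        then have "{z \<in> C. z ! c = x ! c \<and> z ! d = y ! d} = {}" by auto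
        then show ?thesis unfolding eq using e by simp
      qed
    qed
  qed
  have "(\<Sum>z\<in>C. agree_ker x z * agree_ker z y) =
      (\<Sum>z\<in>C. \<Sum>c<f + 2. \<Sum>d<f + 2. of_bool (x ! c = z ! c) * of_bool (z ! d = y ! d))"
    by (simp only: agree_ker_def sum_product)
  also have "\<dots> = (\<Sum>c<f + 2. \<Sum>d<f + 2. \<Sum>z\<in>C. of_bool (x ! c = z ! c) * of_bool (z ! d = y ! d))"
    by (rule sum_rotate[symmetric])
  also have "\<dots> = (\<Sum>c<f + 2. \<Sum>d<f + 2. (if c = d then ?n * of_bool (x ! c = y ! c) - 1 else 0) + 1)"
    by (intro sum.cong refl inner) auto
  also have "\<dots> = (\<Sum>c<f + 2. ?n * of_bool (x ! c = y ! c) + of_nat (f + 1))"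
    by (intro sum.cong refl) (simp add: sum.distrib)
  also have "\<dots> = ?n * agree_ker x y + of_nat (f + 2) * of_nat (f + 1)"
    by (simp only: sum.distrib agree_ker_def sum_distrib_left sum_constant card_lessThan)
  finally show ?thesis .
qed

lemma A_ker_mult:
  assumes "x \<in> C" "y \<in> C"
  defines "n \<equiv> of_nat (q * r)" and "m \<equiv> of_nat (f + 2)"
  shows "(\<Sum>z\<in>C. A_ker x z * A_ker z y) =
    (n - 2 * m) * A_ker x y + m * (n - m) * id_ker x y + m * (m - 1)"
proof -
  have "(\<Sum>z\<in>C. A_ker x z * A_ker z y) =
      (\<Sum>z\<in>C. (agree_ker x z - m * id_ker x z) * (agree_ker z y - m * id_ker z y))"
    using assms by (intro sum.cong refl) (simp only: A_ker_eq)
  also have "\<dots> = (\<Sum>z\<in>C. agree_ker x z * agree_ker z y) - m * (\<Sum>z\<in>C. id_ker x z * agree_ker z y)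
      - m * (\<Sum>z\<in>C. agree_ker x z * id_ker z y) + m * m * (\<Sum>z\<in>C. id_ker x z * id_ker z y)"
    by (simp add: sum_distrib_left sum.distrib sum_subtractf algebra_simps)
  also have "\<dots> = n * agree_ker x y + m * (m - 1) - 2 * m * agree_ker x y + m * m * id_ker x y"
    using assms by (simp add: sum_id_ker agree_ker_mult)
  also have "\<dots> = (n - 2 * m) * A_ker x y + m * (n - m) * id_ker x y + m * (m - 1)"
    using assms by (simp only: A_ker_eq) (simp add: algebra_simps)
  finally show ?thesis .
qed

lemma sum_equiv_right:
  fixes T :: "nat list \<Rightarrow> nat list \<Rightarrow> bool" and S :: "nat list \<Rightarrow> complex"
  assumes "\<And>z. z \<in> C \<Longrightarrow> T z y \<Longrightarrow> S z = S y"
  shows "(\<Sum>z\<in>C. S z * of_bool (T z y)) = S y * (\<Sum>z\<in>C. of_bool (T z y))"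
  using sum_of_bool_mult[of C "\<lambda>z. T z y" S "S y"] assms by (simp add: sum_of_bool)

lemma ker_mult_row:
  assumes "y \<in> C"
  shows "(\<Sum>z\<in>C. block_ker x z * row_ker z y) = of_nat r * block_ker x y"
    "(\<Sum>z\<in>C. row_ker x z * row_ker z y) = of_nat r * row_ker x y"
proof -
  have "(\<Sum>z\<in>C. block_ker x z * row_ker z y) = block_ker x y * (\<Sum>z\<in>C. row_ker z y)"
    by (rule sum_equiv_right[of "\<lambda>z y. z ! 0 = y ! 0 \<and> stack z = stack y" y "block_ker x", folded row_ker_def])
      (auto simp: block_ker_def band_def)
  then show "(\<Sum>z\<in>C. block_ker x z * row_ker z y) = of_nat r * block_ker x y"
    by (simp only: ker_sums(2)[OF assms] mult.commute)
  have "(\<Sum>z\<in>C. row_ker x z * row_ker z y) = row_ker x y * (\<Sum>z\<in>C. row_ker z y)"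
    by (rule sum_equiv_right[of "\<lambda>z y. z ! 0 = y ! 0 \<and> stack z = stack y" y "row_ker x", folded row_ker_def])
      (auto simp: row_ker_def band_def)
  then show "(\<Sum>z\<in>C. row_ker x z * row_ker z y) = of_nat r * row_ker x y"
    by (simp only: ker_sums(2)[OF assms] mult.commute)
qed

lemma ker_mult_col:
  assumes "y \<in> C"
  shows "(\<Sum>z\<in>C. block_ker x z * col_ker z y) = of_nat q * block_ker x y"
    "(\<Sum>z\<in>C. col_ker x z * col_ker z y) = of_nat q * col_ker x y"
proof -
  have "(\<Sum>z\<in>C. block_ker x z * col_ker z y) = block_ker x y * (\<Sum>z\<in>C. col_ker z y)"
    by (rule sum_equiv_right[of "\<lambda>z y. z ! 1 = y ! 1 \<and> band z = band y" y "block_ker x", folded col_ker_def])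
      (auto simp: block_ker_def stack_def)
  then show "(\<Sum>z\<in>C. block_ker x z * col_ker z y) = of_nat q * block_ker x y"
    by (simp only: ker_sums(3)[OF assms] mult.commute)
  have "(\<Sum>z\<in>C. col_ker x z * col_ker z y) = col_ker x y * (\<Sum>z\<in>C. col_ker z y)"
    by (rule sum_equiv_right[of "\<lambda>z y. z ! 1 = y ! 1 \<and> band z = band y" y "col_ker x", folded col_ker_def])
      (auto simp: col_ker_def stack_def)
  then show "(\<Sum>z\<in>C. col_ker x z * col_ker z y) = of_nat q * col_ker x y"
    by (simp only: ker_sums(3)[OF assms] mult.commute)
qed

lemma block_ker_mult_block:
  assumes "y \<in> C"
  shows "(\<Sum>z\<in>C. block_ker x z * block_ker z y) = of_nat (q * r) * block_ker x y"
proof -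
  have "(\<Sum>z\<in>C. block_ker x z * block_ker z y) = block_ker x y * (\<Sum>z\<in>C. block_ker z y)"
    by (rule sum_equiv_right[of "\<lambda>z y. band z = band y \<and> stack z = stack y" y "block_ker x", folded block_ker_def])
      (auto simp: block_ker_def band_def)
  then show "(\<Sum>z\<in>C. block_ker x z * block_ker z y) = of_nat (q * r) * block_ker x y"
    by (simp only: ker_sums(4)[OF assms] mult.commute)
qed

lemma row_col_ker_mult_block:
  assumes "x \<in> C"
  shows "(\<Sum>z\<in>C. row_ker x z * block_ker z y) = of_nat r * block_ker x y"
    "(\<Sum>z\<in>C. col_ker x z * block_ker z y) = of_nat q * block_ker x y"
proof -
  have "(\<Sum>z\<in>C. row_ker x z * block_ker z y) = (\<Sum>z\<in>C. block_ker y z * row_ker z x)"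
    by (intro sum.cong refl) (metis ker_sym(2,4) mult.commute)
  then show "(\<Sum>z\<in>C. row_ker x z * block_ker z y) = of_nat r * block_ker x y"
    unfolding ker_mult_row(1)[OF assms] ker_sym(4)[of x y] .
  have "(\<Sum>z\<in>C. col_ker x z * block_ker z y) = (\<Sum>z\<in>C. block_ker y z * col_ker z x)"
    by (intro sum.cong refl) (metis ker_sym(3,4) mult.commute)
  then show "(\<Sum>z\<in>C. col_ker x z * block_ker z y) = of_nat q * block_ker x y"
    unfolding ker_mult_col(1)[OF assms] ker_sym(4)[of x y] .
qed

lemma row_ker_mult_col:
  assumes xy: "x \<in> C" "y \<in> C"
  shows "(\<Sum>z\<in>C. row_ker x z * col_ker z y) = block_ker x y"
proof -
  have "row_ker x z * col_ker z y = block_ker x y * of_bool (z ! 0 = x ! 0 \<and> z ! 1 = y ! 1)" for z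
    by (auto simp: row_ker_def col_ker_def block_ker_def band_def stack_def)
  then have "(\<Sum>z\<in>C. row_ker x z * col_ker z y) =
      (\<Sum>z\<in>C. block_ker x y * of_bool (z ! 0 = x ! 0 \<and> z ! 1 = y ! 1))"
    by (intro sum.cong refl)
  also have "\<dots> = block_ker x y * of_nat (card {z \<in> C. z ! 0 = x ! 0 \<and> z ! 1 = y ! 1})"
    by (rule sum_of_bool_mult) auto
  finally show ?thesis
    using card_agree_two[of 0 1 x y] xy by simp
qed

lemma col_ker_mult_row:
  assumes xy: "x \<in> C" "y \<in> C"
  shows "(\<Sum>z\<in>C. col_ker x z * row_ker z y) = block_ker x y"
proof -
  have "(\<Sum>z\<in>C. col_ker x z * row_ker z y) = (\<Sum>z\<in>C. row_ker y z * col_ker z x)"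
    by (intro sum.cong refl) (metis ker_sym(2,3) mult.commute)
  then show ?thesis
    unfolding row_ker_mult_col[OF xy(2,1)] ker_sym(4)[of x y] .
qed

lemma B_ker_mult:
  assumes xy: "x \<in> C" "y \<in> C"
  shows "(\<Sum>z\<in>C. B_ker x z * row_ker z y) = (of_nat r - 1) * (block_ker x y - row_ker x y)"
    "(\<Sum>z\<in>C. B_ker x z * col_ker z y) = (of_nat q - 1) * (block_ker x y - col_ker x y)"
    "(\<Sum>z\<in>C. B_ker x z * block_ker z y) = (of_nat q - 1) * (of_nat r - 1) * block_ker x y"
proof -
  have expand: "(\<Sum>z\<in>C. B_ker x z * g z) = (\<Sum>z\<in>C. block_ker x z * g z) - (\<Sum>z\<in>C. row_ker x z * g z)
      - (\<Sum>z\<in>C. col_ker x z * g z) + (\<Sum>z\<in>C. id_ker x z * g z)" for g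
    unfolding sum.distrib[symmetric] sum_subtractf[symmetric]
    by (intro sum.cong refl) (simp only: B_ker_eq[OF xy(1)] left_diff_distrib distrib_right)
  note sums = expand sum_id_ker(2)[OF xy(1)] ker_mult_row[OF xy(2)] ker_mult_col[OF xy(2)]
    block_ker_mult_block[OF xy(2)] row_col_ker_mult_block[OF xy(1)] row_ker_mult_col[OF xy]
    col_ker_mult_row[OF xy]
  show "(\<Sum>z\<in>C. B_ker x z * row_ker z y) = (of_nat r - 1) * (block_ker x y - row_ker x y)"
    unfolding sums by (simp add: algebra_simps)
  show "(\<Sum>z\<in>C. B_ker x z * col_ker z y) = (of_nat q - 1) * (block_ker x y - col_ker x y)"
    unfolding sums by (simp add: algebra_simps)
  show "(\<Sum>z\<in>C. B_ker x z * block_ker z y) = (of_nat q - 1) * (of_nat r - 1) * block_ker x y"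
    unfolding sums by (simp add: algebra_simps)
qed

lemma agree_ker_block:
  assumes xy: "x \<in> C" "y \<in> C"
  shows "agree_ker x y * block_ker x y = row_ker x y + col_ker x y + of_nat f * id_ker x y"
proof -
  have tail: "of_bool (x ! (c + 2) = y ! (c + 2)) * block_ker x y = id_ker x y" if "c < f" for c
  proof -
    have "x ! (c + 2) = y ! (c + 2) \<and> band x = band y \<and> stack x = stack y \<longleftrightarrow> x = y"
      using same_block_symbol_eq[OF xy, of "c + 2"] that by auto
    then show ?thesis
      by (simp only: block_ker_def id_ker_def of_bool_conj[symmetric])
  qed
  have "agree_ker x y = of_bool (x ! 0 = y ! 0) + (of_bool (x ! 1 = y ! 1) +
      (\<Sum>c<f. of_bool (x ! (c + 2) = y ! (c + 2))))"
    by (simp add: agree_ker_def sum.lessThan_Suc_shift del: sum.lessThan_Suc)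
  then have "agree_ker x y * block_ker x y = of_bool (x ! 0 = y ! 0) * block_ker x y +
      of_bool (x ! 1 = y ! 1) * block_ker x y +
      (\<Sum>c<f. of_bool (x ! (c + 2) = y ! (c + 2)) * block_ker x y)"
    by (simp only: sum_distrib_right distrib_right add.assoc)
  also have "(\<Sum>c<f. of_bool (x ! (c + 2) = y ! (c + 2)) * block_ker x y) = (\<Sum>c<f. id_ker x y)"
    using tail by (intro sum.cong refl) auto
  also have "of_bool (x ! 0 = y ! 0) * block_ker x y = row_ker x y"
    by (auto simp: block_ker_def row_ker_def band_def)
  also have "of_bool (x ! 1 = y ! 1) * block_ker x y = col_ker x y"
    by (auto simp: block_ker_def col_ker_def stack_def)
  finally show ?thesis by simp
qed

lemma A_ker_pointwise:
  assumes xy: "x \<in> C" "y \<in> C"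
  shows "A_ker x y * id_ker x y = 0"
    "A_ker x y * row_ker x y = row_ker x y - id_ker x y"
    "A_ker x y * col_ker x y = col_ker x y - id_ker x y"
    "A_ker x y * block_ker x y = row_ker x y + col_ker x y - 2 * id_ker x y"
proof -
  have idb: "id_ker x y * block_ker x y = id_ker x y" by (auto simp: id_ker_def block_ker_def)
  show *: "A_ker x y * block_ker x y = row_ker x y + col_ker x y - 2 * id_ker x y"
    by (simp only: A_ker_eq[OF xy] left_diff_distrib mult.assoc idb agree_ker_block[OF xy]) (simp add: algebra_simps)
  have "x ! 0 = y ! 0 \<and> x ! 1 = y ! 1 \<longleftrightarrow> x = y"
    using code_eq[OF xy, of 0 1] by auto
  then have rc: "row_ker x y * col_ker x y = id_ker x y" "col_ker x y * row_ker x y = id_ker x y"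
    unfolding row_ker_def col_ker_def id_ker_def of_bool_conj[symmetric]
    by (intro arg_cong[of _ _ of_bool], auto simp: band_def stack_def)+
  have br: "block_ker x y * row_ker x y = row_ker x y" and bc: "block_ker x y * col_ker x y = col_ker x y"
    by (auto simp: row_ker_def col_ker_def block_ker_def band_def stack_def)
  have idem: "row_ker x y * row_ker x y = row_ker x y" "col_ker x y * col_ker x y = col_ker x y"
    "id_ker x y * row_ker x y = id_ker x y" "id_ker x y * col_ker x y = id_ker x y"
    by (auto simp: row_ker_def col_ker_def id_ker_def)
  have "A_ker x y * row_ker x y = (A_ker x y * block_ker x y) * row_ker x y"
    by (simp only: mult.assoc br)
  then show "A_ker x y * row_ker x y = row_ker x y - id_ker x y"
    by (simp only: * left_diff_distrib distrib_right mult.assoc idem rc) simp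
  have "A_ker x y * col_ker x y = (A_ker x y * block_ker x y) * col_ker x y"
    by (simp only: mult.assoc bc)
  then show "A_ker x y * col_ker x y = col_ker x y - id_ker x y"
    by (simp only: * left_diff_distrib distrib_right mult.assoc idem rc) simp
  show "A_ker x y * id_ker x y = 0"
    by (auto simp: A_ker_def id_ker_def hamming_dist_def)
qed

subsection \<open>Spectral projections\<close>

definition P_ker :: "complex \<Rightarrow> complex \<Rightarrow> complex \<Rightarrow> nat list \<Rightarrow> nat list \<Rightarrow> complex" where
  "P_ker a b c x y = a * id_ker x y + b + c * A_ker x y"

definition Q_ker :: "complex \<Rightarrow> complex \<Rightarrow> complex \<Rightarrow> complex \<Rightarrow> nat list \<Rightarrow> nat list \<Rightarrow> complex" where
  "Q_ker d g h k x y = d * id_ker x y + g * row_ker x y + h * col_ker x y + k * block_ker x y"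

lemma A_ker_mult_P:
  fixes a b c \<alpha> :: complex
  assumes xy: "x \<in> C" "y \<in> C"
  defines "n \<equiv> of_nat (q * r)" and "m \<equiv> of_nat (f + 2)"
  assumes "c * m * (n - m) = \<alpha> * a" "b * m * (n - 1) + c * m * (m - 1) = \<alpha> * b"
    "a + c * (n - 2 * m) = \<alpha> * c"
  shows "(\<Sum>z\<in>C. A_ker x z * P_ker a b c z y) = \<alpha> * P_ker a b c x y"
proof -
  have sumA: "(\<Sum>z\<in>C. A_ker x z) = m * (n - 1)"
    using ker_sums(7)[OF xy(1)] A_ker_sym[OF xy(1)] unfolding m_def n_def by (metis (no_types, lifting) sum.cong)
  have "(\<Sum>z\<in>C. A_ker x z * P_ker a b c z y) = a * (\<Sum>z\<in>C. A_ker x z * id_ker z y)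
      + b * (\<Sum>z\<in>C. A_ker x z) + c * (\<Sum>z\<in>C. A_ker x z * A_ker z y)"
    unfolding sum_distrib_left sum.distrib[symmetric]
    by (intro sum.cong refl) (simp add: P_ker_def algebra_simps)
  also have "\<dots> = a * A_ker x y + b * (m * (n - 1)) +
      c * ((n - 2 * m) * A_ker x y + m * (n - m) * id_ker x y + m * (m - 1))"
    unfolding sum_id_ker(1)[OF xy(2)] A_ker_mult[OF xy] sumA m_def n_def by (rule refl)
  also have "\<dots> = (c * m * (n - m)) * id_ker x y + (b * m * (n - 1) + c * m * (m - 1)) +
      (a + c * (n - 2 * m)) * A_ker x y"
    by (simp add: algebra_simps)
  also have "\<dots> = \<alpha> * P_ker a b c x y"
    unfolding assms(5-7) P_ker_def by (simp add: algebra_simps)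
  finally show ?thesis .
qed

lemma B_ker_mult_Q:
  fixes d g h k \<beta> :: complex
  assumes xy: "x \<in> C" "y \<in> C"
  defines "q' \<equiv> of_nat q" and "r' \<equiv> of_nat r"
  assumes "d = \<beta> * d" "- d - g * (r' - 1) = \<beta> * g" "- d - h * (q' - 1) = \<beta> * h"
    "d + g * (r' - 1) + h * (q' - 1) + k * (q' - 1) * (r' - 1) = \<beta> * k"
  shows "(\<Sum>z\<in>C. B_ker x z * Q_ker d g h k z y) = \<beta> * Q_ker d g h k x y"
proof -
  have "(\<Sum>z\<in>C. B_ker x z * Q_ker d g h k z y) = d * (\<Sum>z\<in>C. B_ker x z * id_ker z y)
      + g * (\<Sum>z\<in>C. B_ker x z * row_ker z y) + h * (\<Sum>z\<in>C. B_ker x z * col_ker z y)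
      + k * (\<Sum>z\<in>C. B_ker x z * block_ker z y)"
    unfolding sum_distrib_left sum.distrib[symmetric]
    by (intro sum.cong refl) (simp add: Q_ker_def algebra_simps)
  also have "\<dots> = d * (block_ker x y - row_ker x y - col_ker x y + id_ker x y)
      + g * ((r' - 1) * (block_ker x y - row_ker x y)) + h * ((q' - 1) * (block_ker x y - col_ker x y))
      + k * ((q' - 1) * (r' - 1) * block_ker x y)"
    unfolding sum_id_ker(1)[OF xy(2)] B_ker_mult[OF xy] B_ker_eq[OF xy] q'_def r'_def by (rule refl)
  also have "\<dots> = d * id_ker x y + (- d - g * (r' - 1)) * row_ker x y + (- d - h * (q' - 1)) * col_ker x y
      + (d + g * (r' - 1) + h * (q' - 1) + k * (q' - 1) * (r' - 1)) * block_ker x y"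
    by (simp add: algebra_simps)
  also have "\<dots> = (\<beta> * d) * id_ker x y + (\<beta> * g) * row_ker x y + (\<beta> * h) * col_ker x y + (\<beta> * k) * block_ker x y"
    unfolding assms(6-8) using assms(5) by simp
  also have "\<dots> = \<beta> * Q_ker d g h k x y"
    unfolding Q_ker_def by (simp add: algebra_simps)
  finally show ?thesis .
qed

lemma P_Q_trace:
  fixes a b c d g h k :: complex
  defines "q' \<equiv> of_nat q" and "r' \<equiv> of_nat r"
  shows "(\<Sum>x\<in>C. \<Sum>y\<in>C. P_ker a b c x y * Q_ker d g h k y x) = (q' * r')\<^sup>2 *
    (a * (d + g + h + k) + b * (d + g * r' + h * q' + k * (q' * r'))
      + c * (g * (r' - 1) + h * (q' - 1) + k * (q' + r' - 2)))"
proof -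
  have inner: "(\<Sum>y\<in>C. P_ker a b c x y * Q_ker d g h k y x) =
      a * (d + g + h + k) + b * (d + g * r' + h * q' + k * (q' * r'))
      + c * (g * (r' - 1) + h * (q' - 1) + k * (q' + r' - 2))" if x: "x \<in> C" for x
  proof -
    have A_Q: "A_ker x y * Q_ker d g h k y x =
        g * (row_ker y x - id_ker y x) + h * (col_ker y x - id_ker y x)
        + k * (row_ker y x + col_ker y x - 2 * id_ker y x)" if "y \<in> C" for y
    proof -
      have "A_ker x y * Q_ker d g h k y x = d * (A_ker y x * id_ker y x) + g * (A_ker y x * row_ker y x)
          + h * (A_ker y x * col_ker y x) + k * (A_ker y x * block_ker y x)"
        by (simp add: Q_ker_def A_ker_sym[OF x that] algebra_simps)
      then show ?thesis unfolding A_ker_pointwise[OF that x] by simp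
    qed
    have diag: "Q_ker d g h k x x = d + g + h + k"
      by (simp add: Q_ker_def id_ker_def row_ker_def col_ker_def block_ker_def)
    have "(\<Sum>y\<in>C. P_ker a b c x y * Q_ker d g h k y x) = a * (\<Sum>y\<in>C. id_ker x y * Q_ker d g h k y x)
        + b * (\<Sum>y\<in>C. Q_ker d g h k y x) + c * (\<Sum>y\<in>C. A_ker x y * Q_ker d g h k y x)"
      unfolding sum_distrib_left sum.distrib[symmetric]
      by (intro sum.cong refl) (simp add: P_ker_def algebra_simps)
    also have "(\<Sum>y\<in>C. id_ker x y * Q_ker d g h k y x) = d + g + h + k"
      unfolding sum_id_ker(2)[OF x] by (rule diag)
    also have "(\<Sum>y\<in>C. Q_ker d g h k y x) = d * (\<Sum>y\<in>C. id_ker y x) + g * (\<Sum>y\<in>C. row_ker y x)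
        + h * (\<Sum>y\<in>C. col_ker y x) + k * (\<Sum>y\<in>C. block_ker y x)"
      unfolding Q_ker_def sum_distrib_left sum.distrib[symmetric] by (rule refl)
    also have "\<dots> = d + g * r' + h * q' + k * (q' * r')"
      unfolding ker_sums[OF x] by (simp add: q'_def r'_def)
    also have "(\<Sum>y\<in>C. A_ker x y * Q_ker d g h k y x) =
        g * ((\<Sum>y\<in>C. row_ker y x) - (\<Sum>y\<in>C. id_ker y x)) + h * ((\<Sum>y\<in>C. col_ker y x) - (\<Sum>y\<in>C. id_ker y x))
        + k * ((\<Sum>y\<in>C. row_ker y x) + (\<Sum>y\<in>C. col_ker y x) - 2 * (\<Sum>y\<in>C. id_ker y x))"
      unfolding sum_distrib_left sum.distrib[symmetric] sum_subtractf[symmetric]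
      by (intro sum.cong refl A_Q)
    also have "\<dots> = g * (r' - 1) + h * (q' - 1) + k * (q' + r' - 2)"
      unfolding ker_sums[OF x] by (simp add: q'_def r'_def algebra_simps)
    finally show ?thesis .
  qed
  have "(\<Sum>x\<in>C. \<Sum>y\<in>C. P_ker a b c x y * Q_ker d g h k y x) = (\<Sum>x\<in>C.
      a * (d + g + h + k) + b * (d + g * r' + h * q' + k * (q' * r'))
      + c * (g * (r' - 1) + h * (q' - 1) + k * (q' + r' - 2)))"
    by (intro sum.cong refl inner)
  then show ?thesis
    unfolding sum_constant card_C by (simp only: of_nat_power of_nat_mult q'_def r'_def)
qed

lemma B_ker_commutes_P:
  assumes xy: "x \<in> C" "y \<in> C"
    and comm: "(\<Sum>z\<in>C. A_ker x z * B_ker z y) = (\<Sum>z\<in>C. B_ker x z * A_ker z y)"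
  shows "(\<Sum>z\<in>C. B_ker x z * P_ker a b c z y) = (\<Sum>z\<in>C. P_ker a b c x z * B_ker z y)"
proof -
  have "(\<Sum>z\<in>C. B_ker x z) = (\<Sum>z\<in>C. B_ker z x)"
    by (intro sum.cong refl B_ker_sym xy)
  then have sums: "(\<Sum>z\<in>C. B_ker x z) = (\<Sum>z\<in>C. B_ker z y)"
    unfolding ker_sums(6)[OF xy(1)] ker_sums(6)[OF xy(2)] .
  have "(\<Sum>z\<in>C. B_ker x z * P_ker a b c z y) = a * (\<Sum>z\<in>C. B_ker x z * id_ker z y)
      + b * (\<Sum>z\<in>C. B_ker x z) + c * (\<Sum>z\<in>C. B_ker x z * A_ker z y)"
    unfolding sum_distrib_left sum.distrib[symmetric]
    by (intro sum.cong refl) (simp add: P_ker_def algebra_simps)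
  also have "\<dots> = a * (\<Sum>z\<in>C. id_ker x z * B_ker z y)
      + b * (\<Sum>z\<in>C. B_ker z y) + c * (\<Sum>z\<in>C. A_ker x z * B_ker z y)"
    unfolding sum_id_ker(1)[OF xy(2)] sum_id_ker(2)[OF xy(1)] sums comm by (rule refl)
  also have "\<dots> = (\<Sum>z\<in>C. P_ker a b c x z * B_ker z y)"
    unfolding sum_distrib_left sum.distrib[symmetric]
    by (intro sum.cong refl) (simp add: P_ker_def algebra_simps)
  finally show ?thesis .
qed

text \<open>
  The multiplicity \<open>tr (P\<^sub>i Q\<^sub>j)\<close> of \<open>\<alpha>\<^sub>i + \<beta>\<^sub>j\<close>: row 0 belongs to the constant functions, row 1 to the
  functions of a single coordinate with zero sum, row 2 to the orthogonal complement of both.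
\<close>
definition mults :: "int list list" where
  "mults = (let q = int q; r = int r; f = int f in
     [[1, 0, 0, 0],
      [q + r - 2, (q - 1) * (r + f), (r - 1) * (q + f), f * (q - 1) * (r - 1)],
      [(q - 1) * (r - 1), (q - 1) * (q * r - r - f), (r - 1) * (q * r - q - f),
       (q - 1) * (r - 1) * (q * r - f)]])"

definition A_eigs :: "int list" where
  "A_eigs = [(int f + 2) * (int q * int r - 1), int q * int r - (int f + 2), - (int f + 2)]"

definition B_eigs :: "int list" where
  "B_eigs = [(int q - 1) * (int r - 1), - (int r - 1), - (int q - 1), 1]"

definition P_coeffs :: "(complex \<times> complex \<times> complex) list" where
  "P_coeffs = (let n = of_nat q * of_nat r; m = of_nat f + 2 in
     [(0, 1 / n\<^sup>2, 0), (m / n, - m / n\<^sup>2, 1 / n), (1 - m / n, (m - 1) / n\<^sup>2, - 1 / n)])"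

definition Q_coeffs :: "(complex \<times> complex \<times> complex \<times> complex) list" where
  "Q_coeffs = (let q = of_nat q; r = of_nat r in
     [(0, 0, 0, 1 / (q * r)), (0, 1 / r, 0, - 1 / (q * r)), (0, 0, 1 / q, - 1 / (q * r)),
      (1, - 1 / r, - 1 / q, 1 / (q * r))])"

definition P_proj :: "nat \<Rightarrow> nat list \<Rightarrow> nat list \<Rightarrow> complex" where
  "P_proj i = (case P_coeffs ! i of (a, b, c) \<Rightarrow> P_ker a b c)"

definition Q_proj :: "nat \<Rightarrow> nat list \<Rightarrow> nat list \<Rightarrow> complex" where
  "Q_proj j = (case Q_coeffs ! j of (d, g, h, k) \<Rightarrow> Q_ker d g h k)"

lemma less_3_cases: "i < (3::nat) \<Longrightarrow> i = 0 \<or> i = 1 \<or> i = 2" by linarith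

lemma less_4_cases: "i < (4::nat) \<Longrightarrow> i = 0 \<or> i = 1 \<or> i = 2 \<or> i = 3" by linarith

lemma qr_nonzero: "q \<noteq> 0" "r \<noteq> 0"
  using q r by simp_all

lemma A_ker_mult_P_proj:
  assumes "i < 3" "x \<in> C" "y \<in> C"
  shows "(\<Sum>z\<in>C. A_ker x z * P_proj i z y) = of_int (A_eigs ! i) * P_proj i x y"
  using less_3_cases[OF assms(1)]
  by (elim disjE; simp only: P_proj_def P_coeffs_def A_eigs_def Let_def nth_Cons_0 nth_Cons_Suc
      numeral_2_eq_2 One_nat_def prod.case;
      intro A_ker_mult_P[OF assms(2,3)];
      simp add: qr_nonzero field_simps power2_eq_square)

lemma B_ker_mult_Q_proj:
  assumes "j < 4" "x \<in> C" "y \<in> C"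
  shows "(\<Sum>z\<in>C. B_ker x z * Q_proj j z y) = of_int (B_eigs ! j) * Q_proj j x y"
  using less_4_cases[OF assms(1)]
  by (elim disjE; simp only: Q_proj_def Q_coeffs_def B_eigs_def Let_def nth_Cons_0 nth_Cons_Suc
      numeral_2_eq_2 numeral_3_eq_3 One_nat_def prod.case;
      intro B_ker_mult_Q[OF assms(2,3)];
      simp add: qr_nonzero field_simps)

lemma trace_P_Q_proj:
  assumes "i < 3" "j < 4"
  shows "(\<Sum>x\<in>C. \<Sum>y\<in>C. P_proj i x y * Q_proj j y x) = of_int (mults ! i ! j)"
  using less_3_cases[OF assms(1)] less_4_cases[OF assms(2)]
  by (elim disjE; simp only: P_proj_def P_coeffs_def Q_proj_def Q_coeffs_def mults_def Let_def
      nth_Cons_0 nth_Cons_Suc numeral_2_eq_2 numeral_3_eq_3 One_nat_def prod.case P_Q_trace;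
      simp add: qr_nonzero field_simps power2_eq_square)

lemma mults_nonneg:
  assumes "i < 3" "j < 4"
  shows "mults ! i ! j \<ge> 0"
proof -
  have q': "int q \<ge> 1" and r': "int r \<ge> 1" using q r by simp_all
  have rows: "(int q - 1) * (int q * int r - int r - int f) \<ge> 0"
  proof (cases "q > 1")
    case True
    then show ?thesis
      using squares_bound_rows[OF True] q' by (intro mult_nonneg_nonneg) (simp_all flip: of_nat_mult)
  next
    case False
    then have "q = 1" using q by simp
    then show ?thesis by simp
  qed
  have cols: "(int r - 1) * (int q * int r - int q - int f) \<ge> 0"
  proof (cases "r > 1")
    case True
    then show ?thesis
      using squares_bound_columns[OF True] r' by (intro mult_nonneg_nonneg) (simp_all flip: of_nat_mult)
  next
    case False
    then have "r = 1" using r by simp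
    then show ?thesis by simp
  qed
  have "0 \<le> (int r - 1) * ((int q - 1) * (int q * int r - int r - int f) + (int q - 1) * int r)"
    using rows q' r' by (intro mult_nonneg_nonneg[of "int r - 1"] add_nonneg_nonneg) auto
  also have "\<dots> = (int q - 1) * (int r - 1) * (int q * int r - int f)"
    by (simp add: algebra_simps)
  finally have last: "(int q - 1) * (int r - 1) * (int q * int r - int f) \<ge> 0" .
  show ?thesis
    using less_3_cases[OF assms(1)] less_4_cases[OF assms(2)] q' r' rows cols last
    by (elim disjE) (simp_all add: mults_def Let_def numeral_2_eq_2 numeral_3_eq_3)
qed

lemma sum_P_proj: "(\<Sum>i<3. P_proj i x y) = id_ker x y"
  by (simp add: eval_nat_numeral P_proj_def P_coeffs_def Let_def P_ker_def qr_nonzero field_simps)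

lemma sum_Q_proj: "(\<Sum>j<4. Q_proj j x y) = id_ker x y"
  by (simp add: eval_nat_numeral Q_proj_def Q_coeffs_def Let_def Q_ker_def qr_nonzero field_simps)

end

lemma (in mosls_code) spectrum_A_MOSLS:
  assumes xs: "distinct xs" "set xs = C"
    and comm: "A_MOLS f xs * B_mat q r xs = B_mat q r xs * A_MOLS f xs"
  shows "spectrum_mset (A_MOSLS q r f xs) =
    (\<Sum>i<3. \<Sum>j<4. eig (A_eigs ! i + B_eigs ! j) (mults ! i ! j))"
proof -
  have A: "A_MOLS f xs = ker_mat xs A_ker" and B: "B_mat q r xs = ker_mat xs B_ker"
    by (auto simp: A_MOLS_def B_mat_def rel_mat_def ker_mat_def A_ker_def B_ker_def intro!: eq_matI)
  note mult = ker_mat_mult[OF xs(1), unfolded xs(2)]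
  have comm_ker: "(\<Sum>z\<in>C. A_ker x z * B_ker z y) = (\<Sum>z\<in>C. B_ker x z * A_ker z y)"
    if xy: "x \<in> C" "y \<in> C" for x y
  proof -
    obtain i j where ij: "i < length xs" "j < length xs" and x: "x = xs ! i" and y: "y = xs ! j"
      using xy unfolding xs(2)[symmetric] in_set_conv_nth by blast
    have "ker_mat xs (\<lambda>x y. \<Sum>z\<in>C. A_ker x z * B_ker z y) $$ (i, j) =
        ker_mat xs (\<lambda>x y. \<Sum>z\<in>C. B_ker x z * A_ker z y) $$ (i, j)"
      using comm unfolding A B mult by (rule arg_cong)
    then show ?thesis using ij by (simp add: ker_mat_def x y)
  qed
  have smult: "c \<cdot>\<^sub>m ker_mat xs g = ker_mat xs (\<lambda>x y. c * g x y)" for c :: complex and g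
    by (auto simp: ker_mat_def intro!: eq_matI)
  have id_entry: "id_ker (xs ! x) (xs ! y) = (if x = y then 1 else 0)"
    if "x < length xs" "y < length xs" for x y
    using that xs(1) by (simp add: id_ker_def nth_eq_iff_index_eq)
  have "spectrum_mset (A_MOSLS q r f xs) = (\<Sum>i<3. \<Sum>j<4.
      replicate_mset (nat (mults ! i ! j)) (of_int (A_eigs ! i) + of_int (B_eigs ! j)))"
    unfolding spectrum_mset_def A_MOSLS_def A B
  proof (rule proots_char_poly_commuting_sum[where n = "length xs"
        and P = "\<lambda>i. ker_mat xs (P_proj i)" and Q = "\<lambda>j. ker_mat xs (Q_proj j)"])
    show "ker_mat xs A_ker * ker_mat xs (P_proj i) = of_int (A_eigs ! i) \<cdot>\<^sub>m ker_mat xs (P_proj i)"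
      if "i \<in> {..<3}" for i
      unfolding mult smult using that xs(2) by (intro ker_mat_cong A_ker_mult_P_proj) auto
    show "ker_mat xs B_ker * ker_mat xs (P_proj i) = ker_mat xs (P_proj i) * ker_mat xs B_ker" for i
      unfolding mult using xs(2)
      by (intro ker_mat_cong) (auto simp: P_proj_def split: prod.split intro!: B_ker_commutes_P comm_ker)
    show "ker_mat xs B_ker * ker_mat xs (Q_proj j) = of_int (B_eigs ! j) \<cdot>\<^sub>m ker_mat xs (Q_proj j)"
      if "j \<in> {..<4}" for j
      unfolding mult smult using that xs(2) by (intro ker_mat_cong B_ker_mult_Q_proj) auto
    show "(\<Sum>i\<in>{..<3}. ker_mat xs (P_proj i) $$ (x, y)) = (if x = y then 1 else 0)"
      if "x < length xs" "y < length xs" for x y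
      using that sum_P_proj[of "xs ! x" "xs ! y"] id_entry[OF that] by (simp add: ker_mat_def)
    show "(\<Sum>j\<in>{..<4}. ker_mat xs (Q_proj j) $$ (x, y)) = (if x = y then 1 else 0)"
      if "x < length xs" "y < length xs" for x y
      using that sum_Q_proj[of "xs ! x" "xs ! y"] id_entry[OF that] by (simp add: ker_mat_def)
    show "mat_trace (ker_mat xs (P_proj i) * ker_mat xs (Q_proj j)) = of_nat (nat (mults ! i ! j))"
      if "i \<in> {..<3}" "j \<in> {..<4}" for i j
    proof -
      have ij: "i < 3" "j < 4" using that by simp_all
      show ?thesis
        unfolding mult mat_trace_ker_mat[OF xs(1)] xs(2) trace_P_Q_proj[OF ij]
        using mults_nonneg[OF ij] by simp
    qed
  qed simp_all
  then show ?thesis by (simp add: eig_def)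
qed

theorem theorem3p6:
  fixes q r f :: nat
    and L :: "nat \<Rightarrow> nat \<Rightarrow> nat \<Rightarrow> nat"
    and xs :: "nat list list"
  assumes "q \<ge> 1" and "r \<ge> 1" and "f \<ge> 1"
    and "mosls q r f L"
    and "distinct xs" and "set xs = code (q * r) f L"
    and "A_MOLS f xs * B_mat q r xs = B_mat q r xs * A_MOLS f xs"
  shows "spectrum_mset (A_MOSLS q r f xs) =
    (let q = int q; r = int r; f = int f in
       eig ((q - 1) * (r - 1) + (q * r - 1) * (f + 2)) 1
     + eig ((q - 1) * (r - 1) + q * r - 2 - f) (q + r - 2)
     + eig ((q - 1) * (r - 1) - 2 - f) ((q - 1) * (r - 1))
     + eig (q * r - 1 - f) (f * (q - 1) * (r - 1))
     + eig (q * r - q - 1 - f) ((r - 1) * (q + f))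
     + eig (q * r - r - 1 - f) ((q - 1) * (r + f))
     + eig (- 1 - f) ((q - 1) * (r - 1) * (q * r - f))
     + eig (- q - 1 - f) ((r - 1) * (q * r - q - f))
     + eig (- r - 1 - f) ((q - 1) * (q * r - r - f)))"
proof -
  interpret mosls_code q r f L
    using assms by unfold_locales
  show ?thesis
    unfolding spectrum_A_MOSLS[OF assms(5-7)]
    by (simp add: eval_nat_numeral A_eigs_def B_eigs_def mults_def Let_def eig_def[of _ 0] algebra_simps)
      (intro arg_cong2[of _ _ _ _ "(+)"] arg_cong2[of _ _ _ _ eig] refl; simp)
qed

end
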